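(* Let $\mathfrak q=\mathfrak q_{-2}\oplus\mathfrak q_{-1}\oplus\mathfrak q_0\oplus\mathfrak q_1$ be the $9$-dimensional graded Lie algebra of the context, $\mathfrak m=\mathfrak q_{-2}\oplus\mathfrak q_{-1}$. There is no $\mathfrak q_0$-invariant subspace of $(\Lambda^2\mathfrak m^*\otimes\mathfrak q)_1$ complementary to the image of $$\partial:(\mathfrak m^*\otimes\mathfrak q)_1\to(\Lambda^2\mathfrak m^*\otimes\mathfrak q)_1 .$$ In particular, there exists no normalization condition for Cartan geometries of type $(\mathfrak q,Q^0)$.
   Context: Let $\mathfrak g=\bigoplus_{i=-2}^2\mathfrak g_i$ be the split real form of the exceptional simple Lie algebra of type $G_2$ with its contact grading: $\mathfrak g_i$ is the sum of the root spaces of roots with $i$ as coefficient of the long simple root (plus the Cartan subalgebra if $i=0$), so $\mathfrak g_0\cong\mathfrak{gl}(2,\mathbb R)$ and $\mathfrak m=\mathfrak g_{-2}\oplus\mathfrak g_{-1}$ is the $5$-dimensional Heisenberg algebra. Let $\mathfrak q_0\subset\mathfrak g_0$ be the Borel subalgebra, $\mathfrak q_i=\mathfrak g_i$ for $i<0$, $\mathfrak q_1=\{X\in\mathfrak g_1:[X,\mathfrak g_{-1}]\subset\mathfrak q_0\}$ (one-dimensional), and $\mathfrak q=\mathfrak q_{-2}\oplus\mathfrak q_{-1}\oplus\mathfrak q_0\oplus\mathfrak q_1$, a graded subalgebra of $\mathfrak g$ which is the Tanaka prolongation of $(\mathfrak m,\mathfrak q_0)$. $\partial:\Lambda^k\mathfrak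 m^*\otimes\mathfrak q\to\Lambda^{k+1}\mathfrak m^*\otimes\mathfrak q$ is the standard Lie algebra cohomology differential for the $\mathfrak m$-module $\mathfrak q$ (adjoint action); the cochain spaces are graded by homogeneity, a subscript $i$ denoting the subspace of maps homogeneous of degree $i$, and $\partial$ preserves homogeneity. $Q^0$ is a Lie group with Lie algebra $\mathfrak q^0=\mathfrak q_0\oplus\mathfrak q_1$ (acting on $\mathfrak q$ by filtration-preserving automorphisms extending the adjoint action of $\mathfrak q^0$). A normalization condition for Cartan geometries of type $(\mathfrak q,Q^0)$ is a $Q^0$-invariant linear subspace $\mathcal N\subset\Lambda^2(\mathfrak q/\mathfrak q^0)^*\otimes\mathfrak q$ such that for each $i>0$ the degree-$i$ component $\mathrm{gr}(\mathcal N)_i\subset(\Lambda^2\mathfrak m^*\otimes\mathfrak q)_i$ of its associated graded is complementary to the image of $\partial:(\mathfrak m^*\otimes\mathfrak q)_i\to(\Lambda^2\mathfrak m^*\otimes\mathfrak q)_i$. *)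

theory Defs
  imports "HOL-Analysis.Analysis" "HOL-Algebra.Group" "HOL-Library.Function_Algebras"
begin

section \<open>Function spaces as real vector spaces\<close>

instantiation "fun" :: (type, real_vector) real_vector
begin

definition scaleR_fun :: "real \<Rightarrow> ('a \<Rightarrow> 'b) \<Rightarrow> 'a \<Rightarrow> 'b" where
  "scaleR_fun c f = (\<lambda>x. c *\<^sub>R f x)"

instance
  by standard (simp_all add: scaleR_fun_def plus_fun_def fun_eq_iff scaleR_add_right scaleR_add_left)

end

definition complementary :: "'a::real_vector set \<Rightarrow> 'a set \<Rightarrow> 'a set \<Rightarrow> bool" where
  "complementary A B C \<longleftrightarrow> A \<subseteq> C \<and> B \<subseteq> C \<and> A \<inter> B = {0} \<and> {x + y | x y. x \<in> A \<and> y \<in> B} = C"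


section \<open>The split real Lie algebra of type G2\<close>

text \<open>The ambient Lie algebra is the whole finite-dimensional space \<open>'v\<close>; its inner product
  and topology are only used to differentiate maps into it.\<close>

definition lie_algebra :: "('v::real_vector \<Rightarrow> 'v \<Rightarrow> 'v) \<Rightarrow> bool" where
  "lie_algebra br \<longleftrightarrow> bilinear br \<and> (\<forall>x. br x x = 0) \<and>
     (\<forall>x y z. br x (br y z) + br y (br z x) + br z (br x y) = 0)"

definition simple_lie_algebra :: "('v::real_vector \<Rightarrow> 'v \<Rightarrow> 'v) \<Rightarrow> bool" where
  "simple_lie_algebra br \<longleftrightarrow> lie_algebra br \<and> (\<exists>x y. br x y \<noteq> 0) \<and>
     (\<forall>I. subspace I \<and> (\<forall>x. \<forall>y\<in>I. br x y \<in> I) \<longrightarrow> I = {0} \<or> I = UNIV)"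

definition weight_space :: "('v::real_vector \<Rightarrow> 'v \<Rightarrow> 'v) \<Rightarrow> 'v set \<Rightarrow> ('v \<Rightarrow> real) \<Rightarrow> 'v set" where
  "weight_space br h l = {X. \<forall>H\<in>h. br H X = l H *\<^sub>R X}"

definition split_cartan_subalgebra :: "('v::real_vector \<Rightarrow> 'v \<Rightarrow> 'v) \<Rightarrow> 'v set \<Rightarrow> bool" where
  "split_cartan_subalgebra br h \<longleftrightarrow> subspace h \<and> (\<forall>X. X \<in> h \<longleftrightarrow> (\<forall>H\<in>h. br H X = 0)) \<and>
     span (\<Union>l. weight_space br h l) = UNIV"

text \<open>Elements of \<open>h\<^sup>*\<close> are functions on \<open>h\<close>, made unique by extensionality. Linearity on \<open>h\<close>
  need not be demanded: it follows from the existence of a nonzero weight vector.\<close>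

definition roots :: "('v::real_vector \<Rightarrow> 'v \<Rightarrow> 'v) \<Rightarrow> 'v set \<Rightarrow> ('v \<Rightarrow> real) set" where
  "roots br h = {l \<in> extensional h. (\<exists>H\<in>h. l H \<noteq> 0) \<and> weight_space br h l \<noteq> {0}}"

text \<open>Coordinates \<open>(a, b)\<close> of the roots \<open>a \<alpha> + b \<beta>\<close> of G2 with respect to the simple roots
  \<open>\<alpha>\<close> (short) and \<open>\<beta>\<close> (long). As \<open>\<beta> + 3 \<alpha>\<close> is a root, it is indeed \<open>\<beta>\<close> that is long.\<close>

definition G2_coords :: "(int \<times> int) set" where
  "G2_coords = {(1,0), (0,1), (1,1), (2,1), (3,1), (3,2),
                (-1,0), (0,-1), (-1,-1), (-2,-1), (-3,-1), (-3,-2)}"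

definition lincomb :: "('v \<Rightarrow> real) \<Rightarrow> ('v \<Rightarrow> real) \<Rightarrow> int \<times> int \<Rightarrow> 'v \<Rightarrow> real" where
  "lincomb \<alpha> \<beta> p = (\<lambda>H. of_int (fst p) * \<alpha> H + of_int (snd p) * \<beta> H)"

definition split_G2 ::
    "('v::euclidean_space \<Rightarrow> 'v \<Rightarrow> 'v) \<Rightarrow> 'v set \<Rightarrow> ('v \<Rightarrow> real) \<Rightarrow> ('v \<Rightarrow> real) \<Rightarrow> bool" where
  "split_G2 br h \<alpha> \<beta> \<longleftrightarrow> simple_lie_algebra br \<and> split_cartan_subalgebra br h \<and>
     (\<forall>a b. (\<forall>H\<in>h. a * \<alpha> H + b * \<beta> H = 0) \<longrightarrow> a = 0 \<and> b = 0) \<and>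
     roots br h = (\<lambda>p. restrict (lincomb \<alpha> \<beta> p) h) ` G2_coords"

definition contact_grade ::
    "('v::euclidean_space \<Rightarrow> 'v \<Rightarrow> 'v) \<Rightarrow> 'v set \<Rightarrow> ('v \<Rightarrow> real) \<Rightarrow> ('v \<Rightarrow> real) \<Rightarrow> int \<Rightarrow> 'v set" where
  "contact_grade br h \<alpha> \<beta> i =
     span ((\<Union>p\<in>{p \<in> G2_coords. snd p = i}. weight_space br h (lincomb \<alpha> \<beta> p)) \<union>
           (if i = 0 then h else {}))"

text \<open>The Borel subalgebra of \<open>g\<^sub>0\<close> is the one spanned by \<open>h\<close> and the root space of \<open>\<alpha>\<close>. The
  opposite one is also covered: \<open>(-\<alpha>, \<beta> + 3 \<alpha>)\<close> is another simple system with the same grading.\<close>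

definition borel_g0 ::
    "('v::euclidean_space \<Rightarrow> 'v \<Rightarrow> 'v) \<Rightarrow> 'v set \<Rightarrow> ('v \<Rightarrow> real) \<Rightarrow> 'v set" where
  "borel_g0 br h \<alpha> = span (h \<union> weight_space br h \<alpha>)"

definition q_grade ::
    "('v::euclidean_space \<Rightarrow> 'v \<Rightarrow> 'v) \<Rightarrow> 'v set \<Rightarrow> ('v \<Rightarrow> real) \<Rightarrow> ('v \<Rightarrow> real) \<Rightarrow> int \<Rightarrow> 'v set" where
  "q_grade br h \<alpha> \<beta> i =
     (if i < 0 then contact_grade br h \<alpha> \<beta> i
      else if i = 0 then borel_g0 br h \<alpha>
      else if i = 1 then {X \<in> contact_grade br h \<alpha> \<beta> 1.
                            \<forall>Y\<in>contact_grade br h \<alpha> \<beta> (-1). br X Y \<in> borel_g0 br h \<alpha>}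
      else {0})"


section \<open>Cochains of a graded Lie algebra\<close>

text \<open>From here on \<open>q i\<close> is the component of degree \<open>i\<close> of a graded Lie algebra.\<close>

definition whole :: "(int \<Rightarrow> 'v::real_vector set) \<Rightarrow> 'v set" where
  "whole q = span (\<Union>i. q i)"

definition neg_part :: "(int \<Rightarrow> 'v::real_vector set) \<Rightarrow> 'v set" where
  "neg_part q = span (\<Union>i\<in>{..<0}. q i)"

definition filt :: "(int \<Rightarrow> 'v::real_vector set) \<Rightarrow> int \<Rightarrow> 'v set" where
  "filt q k = span (\<Union>i\<in>{k..}. q i)"

definition linear_into ::
    "'v::real_vector set \<Rightarrow> 'w::real_vector set \<Rightarrow> ('v \<Rightarrow> 'w) \<Rightarrow> bool" where
  "linear_into V W f \<longleftrightarrow> (\<forall>x\<in>V. f x \<in> W) \<and> (\<forall>x\<in>V. \<forall>y\<in>V. f (x + y) = f x + f y) \<and>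
     (\<forall>c. \<forall>x\<in>V. f (c *\<^sub>R x) = c *\<^sub>R f x)"

text \<open>\<open>V\<^sup>* \<otimes> W\<close> and \<open>\<Lambda>\<^sup>2 V\<^sup>* \<otimes> W\<close> as spaces of (alternating bi)linear maps on \<open>V\<close>, which are given
  the value 0 off \<open>V\<close> so that they are determined by their values on \<open>V\<close>.\<close>

definition cochains1 :: "'v::real_vector set \<Rightarrow> 'v set \<Rightarrow> ('v \<Rightarrow> 'v) set" where
  "cochains1 V W = {f. linear_into V W f \<and> (\<forall>x. x \<notin> V \<longrightarrow> f x = 0)}"

definition cochains2 :: "'v::real_vector set \<Rightarrow> 'v set \<Rightarrow> ('v \<Rightarrow> 'v \<Rightarrow> 'v) set" where
  "cochains2 V W = {f. (\<forall>x\<in>V. linear_into V W (f x)) \<and> (\<forall>y\<in>V. linear_into V W (\<lambda>x. f x y)) \<and>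
     (\<forall>x\<in>V. f x x = 0) \<and> (\<forall>x y. x \<notin> V \<or> y \<notin> V \<longrightarrow> f x y = 0)}"

definition homogeneous1 :: "(int \<Rightarrow> 'v::real_vector set) \<Rightarrow> int \<Rightarrow> ('v \<Rightarrow> 'v) set" where
  "homogeneous1 q i = {f \<in> cochains1 (neg_part q) (whole q). \<forall>a<0. \<forall>x\<in>q a. f x \<in> q (a + i)}"

definition homogeneous2 :: "(int \<Rightarrow> 'v::real_vector set) \<Rightarrow> int \<Rightarrow> ('v \<Rightarrow> 'v \<Rightarrow> 'v) set" where
  "homogeneous2 q i = {f \<in> cochains2 (neg_part q) (whole q).
     \<forall>a<0. \<forall>b<0. \<forall>x\<in>q a. \<forall>y\<in>q b. f x y \<in> q (a + b + i)}"

definition coboundary ::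
    "('v::real_vector \<Rightarrow> 'v \<Rightarrow> 'v) \<Rightarrow> (int \<Rightarrow> 'v set) \<Rightarrow> ('v \<Rightarrow> 'v) \<Rightarrow> 'v \<Rightarrow> 'v \<Rightarrow> 'v" where
  "coboundary br q f = (\<lambda>x y. if x \<in> neg_part q \<and> y \<in> neg_part q
     then br x (f y) - br y (f x) - f (br x y) else 0)"

definition inf_action ::
    "('v::real_vector \<Rightarrow> 'v \<Rightarrow> 'v) \<Rightarrow> (int \<Rightarrow> 'v set) \<Rightarrow> 'v \<Rightarrow> ('v \<Rightarrow> 'v \<Rightarrow> 'v) \<Rightarrow> 'v \<Rightarrow> 'v \<Rightarrow> 'v" where
  "inf_action br q A f = (\<lambda>x y. if x \<in> neg_part q \<and> y \<in> neg_part q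
     then br A (f x y) - f (br A x) y - f x (br A y) else 0)"


section \<open>Lie groups\<close>

text \<open>On an open set, \<open>C\<^sup>k\<^sup>+\<^sup>1\<close> means differentiable with all partial derivatives of class \<open>C\<^sup>k\<close>.\<close>

primrec Ck_on :: "nat \<Rightarrow> 'a::euclidean_space set \<Rightarrow> ('a \<Rightarrow> 'b::real_normed_vector) \<Rightarrow> bool" where
  "Ck_on 0 S f = continuous_on S f"
| "Ck_on (Suc k) S f = ((\<forall>x\<in>S. f differentiable (at x)) \<and>
     (\<forall>b\<in>Basis. Ck_on k S (\<lambda>x. frechet_derivative f (at x) b)))"

definition smooth_on :: "'a::euclidean_space set \<Rightarrow> ('a \<Rightarrow> 'b::real_normed_vector) \<Rightarrow> bool" where
  "smooth_on S f \<longleftrightarrow> open S \<and> (\<forall>k. Ck_on k S f)"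

text \<open>A chart is a pair of its domain \<open>U\<close> and its coordinate map \<open>\<phi>\<close>.\<close>

definition chart :: "'g topology \<Rightarrow> 'g set \<times> ('g \<Rightarrow> 'e::euclidean_space) \<Rightarrow> bool" where
  "chart T = (\<lambda>(U, \<phi>). openin T U \<and> open (\<phi> ` U) \<and>
     homeomorphic_map (subtopology T U) (top_of_set (\<phi> ` U)) \<phi>)"

definition smooth_manifold :: "'g topology \<Rightarrow> ('g set \<times> ('g \<Rightarrow> 'e::euclidean_space)) set \<Rightarrow> bool" where
  "smooth_manifold T \<A> \<longleftrightarrow> Hausdorff_space T \<and>
     (\<exists>\<B>. countable \<B> \<and> (\<forall>B\<in>\<B>. openin T B) \<and>
        (\<forall>U x. openin T U \<and> x \<in> U \<longrightarrow> (\<exists>B\<in>\<B>. x \<in> B \<and> B \<subseteq> U))) \<and>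
     (\<forall>c\<in>\<A>. chart T c) \<and> \<Union>(fst ` \<A>) = topspace T \<and>
     (\<forall>(U, \<phi>)\<in>\<A>. \<forall>(V, \<psi>)\<in>\<A>. smooth_on (\<phi> ` (U \<inter> V)) (\<lambda>x. \<psi> (inv_into U \<phi> x)))"

definition lie_group ::
    "('g, 'm) monoid_scheme \<Rightarrow> 'g topology \<Rightarrow> ('g set \<times> ('g \<Rightarrow> 'e::euclidean_space)) set \<Rightarrow> bool" where
  "lie_group G T \<A> \<longleftrightarrow> group G \<and> carrier G = topspace T \<and> smooth_manifold T \<A> \<and>
     (\<forall>(U, \<phi>)\<in>\<A>. \<forall>(V, \<psi>)\<in>\<A>. \<forall>(W, \<theta>)\<in>\<A>.
        smooth_on {(x, y). x \<in> \<phi> ` U \<and> y \<in> \<psi> ` V \<and> inv_into U \<phi> x \<otimes>\<^bsub>G\<^esub> inv_into V \<psi> y \<in> W}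
          (\<lambda>(x, y). \<theta> (inv_into U \<phi> x \<otimes>\<^bsub>G\<^esub> inv_into V \<psi> y))) \<and>
     (\<forall>(U, \<phi>)\<in>\<A>. \<forall>(W, \<theta>)\<in>\<A>.
        smooth_on {x. x \<in> \<phi> ` U \<and> inv\<^bsub>G\<^esub> (inv_into U \<phi> x) \<in> W}
          (\<lambda>x. \<theta> (inv\<^bsub>G\<^esub> (inv_into U \<phi> x))))"

text \<open>The Lie algebra of \<open>G\<close> is the tangent space at the identity, identified with the model space
  \<open>'e\<close> by a chart \<open>(U, \<phi>)\<close> around the identity, with the bracket of left-invariant vector fields.\<close>

definition left_invariant_field ::
    "('g, 'm) monoid_scheme \<Rightarrow> 'g set \<Rightarrow> ('g \<Rightarrow> 'e::euclidean_space) \<Rightarrow> 'e \<Rightarrow> 'e \<Rightarrow> 'e" where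
  "left_invariant_field G U \<phi> u x =
     frechet_derivative (\<lambda>y. \<phi> (inv_into U \<phi> x \<otimes>\<^bsub>G\<^esub> inv_into U \<phi> y)) (at (\<phi> \<one>\<^bsub>G\<^esub>)) u"

definition lie_group_bracket ::
    "('g, 'm) monoid_scheme \<Rightarrow> 'g set \<Rightarrow> ('g \<Rightarrow> 'e::euclidean_space) \<Rightarrow> 'e \<Rightarrow> 'e \<Rightarrow> 'e" where
  "lie_group_bracket G U \<phi> u v =
     frechet_derivative (left_invariant_field G U \<phi> v) (at (\<phi> \<one>\<^bsub>G\<^esub>)) u -
     frechet_derivative (left_invariant_field G U \<phi> u) (at (\<phi> \<one>\<^bsub>G\<^esub>)) v"

definition lie_group_Ad ::
    "('g, 'm) monoid_scheme \<Rightarrow> 'g set \<Rightarrow> ('g \<Rightarrow> 'e::euclidean_space) \<Rightarrow> 'g \<Rightarrow> 'e \<Rightarrow> 'e" where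
  "lie_group_Ad G U \<phi> g u =
     frechet_derivative (\<lambda>x. \<phi> (g \<otimes>\<^bsub>G\<^esub> inv_into U \<phi> x \<otimes>\<^bsub>G\<^esub> inv\<^bsub>G\<^esub> g)) (at (\<phi> \<one>\<^bsub>G\<^esub>)) u"

text \<open>\<open>model_pair br q G T \<A> \<rho>\<close>: \<open>G\<close> is a Lie group whose Lie algebra is identified by \<open>L\<close> with the
  nonnegative part \<open>q\<^sup>0\<close> of \<open>q\<close>, and \<open>\<rho>\<close> is a smooth action of \<open>G\<close> on \<open>q\<close> by filtration-preserving
  Lie algebra automorphisms that extends the adjoint representation of \<open>G\<close> on \<open>q\<^sup>0\<close> and has the
  adjoint action of \<open>q\<^sup>0\<close> on \<open>q\<close> as its derivative.\<close>

definition model_pair ::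
    "('v::euclidean_space \<Rightarrow> 'v \<Rightarrow> 'v) \<Rightarrow> (int \<Rightarrow> 'v set) \<Rightarrow> ('g, 'm) monoid_scheme \<Rightarrow> 'g topology \<Rightarrow>
     ('g set \<times> ('g \<Rightarrow> 'e::euclidean_space)) set \<Rightarrow> ('g \<Rightarrow> 'v \<Rightarrow> 'v) \<Rightarrow> bool" where
  "model_pair br q G T \<A> \<rho> \<longleftrightarrow> lie_group G T \<A> \<and>
     (\<forall>g\<in>carrier G. linear_into (whole q) (whole q) (\<rho> g) \<and> bij_betw (\<rho> g) (whole q) (whole q) \<and>
        (\<forall>x\<in>whole q. \<forall>y\<in>whole q. \<rho> g (br x y) = br (\<rho> g x) (\<rho> g y)) \<and>
        (\<forall>k. \<rho> g ` filt q k \<subseteq> filt q k)) \<and>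
     (\<forall>x\<in>whole q. \<rho> \<one>\<^bsub>G\<^esub> x = x) \<and>
     (\<forall>g\<in>carrier G. \<forall>g'\<in>carrier G. \<forall>x\<in>whole q. \<rho> (g \<otimes>\<^bsub>G\<^esub> g') x = \<rho> g (\<rho> g' x)) \<and>
     (\<forall>(U, \<phi>)\<in>\<A>. \<forall>x\<in>whole q. smooth_on (\<phi> ` U) (\<lambda>t. \<rho> (inv_into U \<phi> t) x)) \<and>
     (\<exists>U \<phi> L. (U, \<phi>) \<in> \<A> \<and> \<one>\<^bsub>G\<^esub> \<in> U \<and> linear L \<and> bij_betw L UNIV (filt q 0) \<and>
        (\<forall>u v. L (lie_group_bracket G U \<phi> u v) = br (L u) (L v)) \<and>
        (\<forall>g\<in>carrier G. \<forall>u. \<rho> g (L u) = L (lie_group_Ad G U \<phi> g u)) \<and>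
        (\<forall>u. \<forall>x\<in>whole q.
           frechet_derivative (\<lambda>t. \<rho> (inv_into U \<phi> t) x) (at (\<phi> \<one>\<^bsub>G\<^esub>)) u = br (L u) x))"


section \<open>Normalization conditions\<close>

text \<open>\<open>\<Lambda>\<^sup>2(q/q\<^sup>0)\<^sup>* \<otimes> q\<close> as the space of alternating maps on \<open>q\<close> annihilated by \<open>q\<^sup>0\<close>.\<close>

definition horizontal2 :: "(int \<Rightarrow> 'v::real_vector set) \<Rightarrow> ('v \<Rightarrow> 'v \<Rightarrow> 'v) set" where
  "horizontal2 q = {f \<in> cochains2 (whole q) (whole q). \<forall>x\<in>filt q 0. \<forall>y\<in>whole q. f x y = 0}"

definition filtered2 :: "(int \<Rightarrow> 'v::real_vector set) \<Rightarrow> int \<Rightarrow> ('v \<Rightarrow> 'v \<Rightarrow> 'v) set" where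
  "filtered2 q i = {f \<in> horizontal2 q.
     \<forall>a b. \<forall>x\<in>filt q a. \<forall>y\<in>filt q b. f x y \<in> filt q (a + b + i)}"

text \<open>The degree \<open>i\<close> component of the associated graded of \<open>N\<close>, i.e. the quotient of
  \<open>N \<inter> F\<^sup>i\<close> by \<open>N \<inter> F\<^sup>i\<^sup>+\<^sup>1\<close>, as a subspace of \<open>(\<Lambda>\<^sup>2 m\<^sup>* \<otimes> q)\<^sub>i\<close>:
  it consists of the leading parts of the elements of \<open>N \<inter> F\<^sup>i\<close>.\<close>

definition gr2 ::
    "(int \<Rightarrow> 'v::real_vector set) \<Rightarrow> int \<Rightarrow> ('v \<Rightarrow> 'v \<Rightarrow> 'v) set \<Rightarrow> ('v \<Rightarrow> 'v \<Rightarrow> 'v) set" where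
  "gr2 q i N = {f0 \<in> homogeneous2 q i. \<exists>f\<in>N \<inter> filtered2 q i.
     \<forall>a<0. \<forall>b<0. \<forall>x\<in>q a. \<forall>y\<in>q b. f x y - f0 x y \<in> filt q (a + b + i + 1)}"

definition group_act2 ::
    "(int \<Rightarrow> 'v::real_vector set) \<Rightarrow> ('g, 'm) monoid_scheme \<Rightarrow> ('g \<Rightarrow> 'v \<Rightarrow> 'v) \<Rightarrow> 'g \<Rightarrow>
     ('v \<Rightarrow> 'v \<Rightarrow> 'v) \<Rightarrow> 'v \<Rightarrow> 'v \<Rightarrow> 'v" where
  "group_act2 q G \<rho> g f = (\<lambda>x y. if x \<in> whole q \<and> y \<in> whole q
     then \<rho> g (f (\<rho> (inv\<^bsub>G\<^esub> g) x) (\<rho> (inv\<^bsub>G\<^esub> g) y)) else 0)"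

definition normalization_condition ::
    "('v::real_vector \<Rightarrow> 'v \<Rightarrow> 'v) \<Rightarrow> (int \<Rightarrow> 'v set) \<Rightarrow> ('g, 'm) monoid_scheme \<Rightarrow>
     ('g \<Rightarrow> 'v \<Rightarrow> 'v) \<Rightarrow> ('v \<Rightarrow> 'v \<Rightarrow> 'v) set \<Rightarrow> bool" where
  "normalization_condition br q G \<rho> N \<longleftrightarrow> subspace N \<and> N \<subseteq> horizontal2 q \<and>
     (\<forall>g\<in>carrier G. \<forall>f\<in>N. group_act2 q G \<rho> g f \<in> N) \<and>
     (\<forall>i>0. complementary (gr2 q i N) (coboundary br q ` homogeneous1 q i) (homogeneous2 q i))"

end

theory Submission
  imports Defs
begin

text \<open>By positive definiteness of the trace form on the split Cartan subalgebra, every root vector lies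
  in an sl2-triple and root spaces are lines. For G2 this yields a root vector \<open>E\<close> of \<open>\<alpha>\<close> and a basis
  \<open>x0, x1, x2, x3\<close> of \<open>q (-1)\<close> that \<open>E\<close> shifts by \<open>x3 \<mapsto> x2 \<mapsto> x1 \<mapsto> x0 \<mapsto> 0\<close>, the only nonzero brackets
  in the negative part being \<open>[x0, x3] = z = - [x1, x2]\<close>.

  The cochain \<open>c = 4 (x0\<^sup>* \<and> x1\<^sup>*) \<otimes> x2 + 3 (x0\<^sup>* \<and> x2\<^sup>*) \<otimes> x3\<close> has a weight that does not occur among the
  coboundaries, but \<open>E \<cdot> c\<close> is a coboundary. If \<open>c = n + \<partial> f\<close> with \<open>n\<close> in an invariant complement, then
  \<open>E \<cdot> n\<close> is both in the complement and a coboundary, so \<open>E \<cdot> c = E \<cdot> \<partial> f\<close>. But at \<open>(x0, x1)\<close> the left-hand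
  side is \<open>4 x1\<close>, while the right-hand side is a multiple of \<open>x0\<close>, because \<open>q 0\<close> preserves the flag spanned by
  \<open>x0\<close> and \<open>x1\<close>.

  For a normalization condition \<open>N\<close>, differentiating the group action along curves through the unit
  shows that its associated graded in degree 1 is such an invariant complement.\<close>

section \<open>Root spaces of a split simple Lie algebra\<close>

text \<open>Used for brackets of spans: closure of graded pieces under the bracket then only has to
  be checked on root vectors or on homogeneous elements.\<close>

lemma bilinear_span_mem:
  assumes "bilinear f" "subspace V" "\<And>x y. x \<in> S \<Longrightarrow> y \<in> T \<Longrightarrow> f x y \<in> V"
    and "x \<in> span S" "y \<in> span T"
  shows "f x y \<in> V"
proof -
  have lin: "linear (f x)" "linear (\<lambda>x. f x y)" for x y
    using assms(1) unfolding bilinear_def by auto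
  have 1: "f x y \<in> V" if "x \<in> S" for x
  proof -
    have "f x ` span T \<subseteq> V"
      unfolding linear_span_image[OF lin(1), symmetric] using assms(2,3) that
      by (intro span_minimal) auto
    then show ?thesis using assms(5) by blast
  qed
  have "(\<lambda>x. f x y) ` span S \<subseteq> V"
    unfolding linear_span_image[OF lin(2), symmetric] using assms(2) 1
    by (intro span_minimal) auto
  then show ?thesis using assms(4) by blast
qed

text \<open>Apply \<open>T\<close> to an expansion of \<open>x\<close> in \<open>S\<close> and
  subtract \<open>\<mu> x\<close> times the expansion. The relation that remains has all its vectors
  in \<open>S\<close>, so by induction its coefficients vanish, and the eigenvalues are
  distinct.\<close>

lemma independent_eigenvectors:
  fixes T :: "'a::real_vector \<Rightarrow> 'a"
  assumes "linear T" "finite S" "\<And>x. x \<in> S \<Longrightarrow> x \<noteq> 0 \<and> T x = \<mu> x *\<^sub>R x" "inj_on \<mu> S"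
  shows "independent S"
  using assms(2-4)
proof (induction S rule: finite_induct)
  case empty
  show ?case by (rule independent_empty)
next
  case (insert x S)
  have ind: "independent S" using insert by (auto simp: inj_on_def)
  have "x \<notin> span S"
  proof
    assume "x \<in> span S"
    then obtain a where a: "x = (\<Sum>y\<in>S. a y *\<^sub>R y)"
      using span_finite[OF insert(1)] by auto
    have "T x = (\<Sum>y\<in>S. (a y * \<mu> y) *\<^sub>R y)"
      unfolding a linear_sum[OF assms(1)] linear_scale[OF assms(1)]
      using insert.prems(1) by (intro sum.cong) auto
    moreover have "T x = (\<Sum>y\<in>S. (a y * \<mu> x) *\<^sub>R y)"
    proof -
      have "T x = \<mu> x *\<^sub>R x" using insert.prems(1) by simp
      also have "\<dots> = \<mu> x *\<^sub>R (\<Sum>y\<in>S. a y *\<^sub>R y)" by (rule arg_cong[OF a])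
      finally show ?thesis by (simp add: scaleR_sum_right mult.commute)
    qed
    ultimately have "(\<Sum>y\<in>S. (a y * \<mu> y - a y * \<mu> x) *\<^sub>R y) = 0"
      by (simp add: scaleR_left_diff_distrib sum_subtractf)
    then have z: "a y * \<mu> y - a y * \<mu> x = 0" if "y \<in> S" for y
      by (rule independentD[OF ind insert(1) order_refl _ that])
    have "a y = 0" if "y \<in> S" for y
    proof -
      have "\<mu> y \<noteq> \<mu> x"
        using inj_onD[OF insert.prems(2), of y x] insert(2) that by auto
      then show ?thesis using z[OF that] by (simp flip: right_diff_distrib)
    qed
    then have "x = 0" using a by simp
    then show False using insert.prems(1) by simp
  qed
  then show ?case using ind insert(2) by (simp add: independent_insert)
qed

text \<open>The trace of \<open>f\<close>, read off a chosen basis. In a basis of weight vectors the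
  Cartan subalgebra acts diagonally, which makes the trace form computable there.\<close>

definition basis_trace :: "'v::real_vector set \<Rightarrow> ('v \<Rightarrow> 'v) \<Rightarrow> real" where
  "basis_trace B f = (\<Sum>b\<in>B. representation B (f b) b)"

text \<open>Both traces are the same double sum of products of matrix entries of \<open>f\<close>
  and \<open>g\<close>, summed in the two possible orders.\<close>

lemma basis_trace_commute:
  assumes "finite B" "independent B" "span B = UNIV" "linear f" "linear g"
  shows "basis_trace B (\<lambda>x. f (g x)) = basis_trace B (\<lambda>x. g (f x))"
proof -
  have comp: "representation B (F (G b)) b =
      (\<Sum>c\<in>B. representation B (G b) c * representation B (F c) b)"
    if "linear F" for F G :: "'a \<Rightarrow> 'a" and b
  proof -
    have "G b = (\<Sum>c\<in>B. representation B (G b) c *\<^sub>R c)"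
      using assms by (simp add: sum_representation_eq)
    then have "F (G b) = F (\<Sum>c\<in>B. representation B (G b) c *\<^sub>R c)"
      by (rule arg_cong)
    also have "\<dots> = (\<Sum>c\<in>B. representation B (G b) c *\<^sub>R F c)"
      using that by (simp add: linear_sum linear_scale)
    finally show ?thesis
      using assms by (simp add: representation_sum representation_scale)
  qed
  have "basis_trace B (\<lambda>x. f (g x)) =
      (\<Sum>b\<in>B. \<Sum>c\<in>B. representation B (g b) c * representation B (f c) b)"
    unfolding basis_trace_def by (simp add: comp[OF \<open>linear f\<close>])
  also have "\<dots> = (\<Sum>c\<in>B. \<Sum>b\<in>B. representation B (f c) b * representation B (g b) c)"
    by (subst sum.swap) (simp add: mult.commute)
  also have "\<dots> = basis_trace B (\<lambda>x. g (f x))"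
    unfolding basis_trace_def by (simp add: comp[OF \<open>linear g\<close>])
  finally show ?thesis .
qed

lemma basis_trace_diff:
  assumes "independent B" "span B = UNIV"
  shows "basis_trace B (\<lambda>x. f x - g x) = basis_trace B f - basis_trace B g"
  unfolding basis_trace_def using assms by (simp add: representation_diff sum_subtractf)

lemma basis_trace_add:
  assumes "independent B" "span B = UNIV"
  shows "basis_trace B (\<lambda>x. f x + g x) = basis_trace B f + basis_trace B g"
  unfolding basis_trace_def using assms by (simp add: representation_add sum.distrib)

lemma basis_trace_scale:
  assumes "independent B" "span B = UNIV"
  shows "basis_trace B (\<lambda>x. c *\<^sub>R f x) = c * basis_trace B f"
  unfolding basis_trace_def using assms by (simp add: representation_scale sum_distrib_left)

section \<open>Killing form, sl2-triples and one-dimensional root spaces\<close>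

locale split_simple =
  fixes br :: "'v::euclidean_space \<Rightarrow> 'v \<Rightarrow> 'v" and h :: "'v set"
  assumes simple: "simple_lie_algebra br" and cartan: "split_cartan_subalgebra br h"
begin

abbreviation "wsp \<equiv> weight_space br h"

lemma bilinear_br: "bilinear br" and br_self [simp]: "br x x = 0"
  and jacobi_cyc: "br x (br y z) + br y (br z x) + br z (br x y) = 0"
  and nonabelian: "\<exists>x y. br x y \<noteq> 0"
  using simple unfolding simple_lie_algebra_def lie_algebra_def by blast+

lemma ideal_trivial: "subspace I \<Longrightarrow> (\<And>x y. y \<in> I \<Longrightarrow> br x y \<in> I) \<Longrightarrow> I = {0} \<or> I = UNIV"
  using simple unfolding simple_lie_algebra_def by blast

lemmas br_simps = bilinear_ladd[OF bilinear_br] bilinear_radd[OF bilinear_br]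
  bilinear_lmul[OF bilinear_br] bilinear_rmul[OF bilinear_br]
  bilinear_lsub[OF bilinear_br] bilinear_rsub[OF bilinear_br]
  bilinear_lneg[OF bilinear_br] bilinear_rneg[OF bilinear_br]
  bilinear_lzero[OF bilinear_br] bilinear_rzero[OF bilinear_br]

lemma linear_br: "linear (br x)"
  using bilinear_br unfolding bilinear_def by blast

lemma br_skew: "br y x = - br x y"
proof -
  have "br (x + y) (x + y) = 0" by (rule br_self)
  then have "br x y + br y x = 0" by (simp only: br_simps) (simp add: add.commute)
  then show ?thesis by (metis add.commute add_eq_0_iff)
qed

lemma jacobi: "br x (br y z) = br (br x y) z + br y (br x z)"
proof -
  have "br x (br y z) = - br y (br z x) - br z (br x y)"
    using jacobi_cyc[of x y z] by (metis add.assoc add_eq_0_iff2 minus_add_distrib uminus_add_conv_diff add.commute)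
  also have "\<dots> = br (br x y) z + br y (br x z)"
    using br_skew[of z "br x y"] br_skew[of z x] by (simp add: br_simps)
  finally show ?thesis .
qed

lemma subspace_h: "subspace h" and h_iff: "X \<in> h \<longleftrightarrow> (\<forall>H\<in>h. br H X = 0)"
  and span_weights: "span (\<Union>l. wsp l) = UNIV"
  using cartan unfolding split_cartan_subalgebra_def by blast+

lemma subspace_wsp: "subspace (wsp l)"
  unfolding subspace_def weight_space_def
  by (simp add: br_simps scaleR_add_right scaleR_left_commute)

lemma wsp_cong: "(\<And>H. H \<in> h \<Longrightarrow> l H = m H) \<Longrightarrow> wsp l = wsp m"
  unfolding weight_space_def by auto

lemma wsp_zero: "wsp (\<lambda>H. 0) = h"
  unfolding weight_space_def by (simp add: set_eq_iff flip: h_iff)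

lemma wspD: "X \<in> wsp l \<Longrightarrow> H \<in> h \<Longrightarrow> br H X = l H *\<^sub>R X"
  unfolding weight_space_def by blast

lemma wsp_br:
  assumes "x \<in> wsp l" "y \<in> wsp m"
  shows "br x y \<in> wsp (\<lambda>H. l H + m H)"
  unfolding weight_space_def
proof (rule CollectI, rule ballI)
  fix H assume "H \<in> h"
  then show "br H (br x y) = (l H + m H) *\<^sub>R br x y"
    by (subst jacobi) (simp add: wspD[OF assms(1)] wspD[OF assms(2)] br_simps scaleR_add_left)
qed

text \<open>The line through a central element is an ideal. By simplicity it is zero or everything,
  and in the latter case all brackets would vanish.\<close>

lemma center_trivial:
  assumes "\<And>x. br x z = 0"
  shows "z = 0"
proof -
  have "span {z} = {0} \<or> span {z} = UNIV"
    proof (rule ideal_trivial[OF subspace_span])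
    fix x y assume "y \<in> span {z}"
    then obtain c where "y = c *\<^sub>R z" unfolding span_singleton by blast
    then have "br x y = 0" by (simp add: br_simps assms)
    then show "br x y \<in> span {z}" by (simp add: span_zero)
  qed
  moreover have "span {z} \<noteq> UNIV"
  proof
    assume *: "span {z} = UNIV"
    have "br x y = 0" for x y
    proof -
      obtain c where "y = c *\<^sub>R z" using * unfolding span_singleton by blast
      then show ?thesis by (simp add: br_simps assms)
    qed
    then show False using nonabelian by blast
  qed
  ultimately show ?thesis using span_base[of z "{z}"] by auto
qed

lemma weight_basis_exists:
  obtains B where "finite B" "independent B" "span B = UNIV" "\<And>b. b \<in> B \<Longrightarrow> \<exists>l. b \<in> wsp l"
proof -
  obtain B where B: "B \<subseteq> (\<Union>l. wsp l)" "independent B" "(\<Union>l. wsp l) \<subseteq> span B"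
    using maximal_independent_subset[of "\<Union>l. wsp l"] by blast
  have "span B = UNIV"
    using span_minimal[OF B(3) subspace_span] span_weights by auto
  with B show ?thesis using that[of B] finiteI_independent by blast
qed

text \<open>This is the Killing form. Its invariance is cyclicity of the trace. On the Cartan
  subalgebra it is a sum of squares of the real eigenvalues of \<open>br H\<close>, which vanish
  together only if \<open>H\<close> is central.\<close>

lemma invariant_form_exists:
  obtains \<kappa> :: "'v \<Rightarrow> 'v \<Rightarrow> real"
  where "bilinear \<kappa>" "\<And>x y z. \<kappa> (br x y) z = \<kappa> x (br y z)"
    "\<And>H. H \<in> h \<Longrightarrow> H \<noteq> 0 \<Longrightarrow> \<kappa> H H > 0"
proof -
  obtain B where B: "finite B" "independent B" "span B = UNIV" "\<And>b. b \<in> B \<Longrightarrow> \<exists>l. b \<in> wsp l"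
    by (rule weight_basis_exists) blast
  define \<kappa> where "\<kappa> x y = basis_trace B (\<lambda>v. br x (br y v))" for x y
  have bil: "bilinear \<kappa>"
    unfolding bilinear_def linear_iff \<kappa>_def
    by (simp add: br_simps basis_trace_add[OF B(2,3)] basis_trace_scale[OF B(2,3)])
  have inv: "\<kappa> (br x y) z = \<kappa> x (br y z)" for x y z
  proof -
    have "\<kappa> (br x y) z = basis_trace B (\<lambda>v. br x (br y (br z v)) - br y (br x (br z v)))"
      unfolding \<kappa>_def by (rule arg_cong[of _ _ "basis_trace B"], rule ext) (simp add: jacobi[of x y])
    also have "\<dots> = basis_trace B (\<lambda>v. br x (br y (br z v))) - basis_trace B (\<lambda>v. br y (br x (br z v)))"
      by (rule basis_trace_diff[OF B(2,3)])
    \<comment> \<open>Cyclicity moves \<open>br y\<close> from the front of the product to its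
      end.\<close>
    also have "basis_trace B (\<lambda>v. br y (br x (br z v))) = basis_trace B (\<lambda>v. br x (br z (br y v)))"
      using basis_trace_commute[OF B(1-3), of "br y" "\<lambda>v. br x (br z v)"]
        linear_compose[OF linear_br linear_br] linear_br by (simp add: o_def)
    also have "basis_trace B (\<lambda>v. br x (br y (br z v))) - \<dots> =
        basis_trace B (\<lambda>v. br x (br y (br z v)) - br x (br z (br y v)))"
      by (rule basis_trace_diff[OF B(2,3), symmetric])
    also have "\<dots> = \<kappa> x (br y z)"
      unfolding \<kappa>_def
      by (rule arg_cong[of _ _ "basis_trace B"], rule ext) (simp add: jacobi[of y z] br_simps)
    finally show ?thesis .
  qed
  have pos: "\<kappa> H H > 0" if H: "H \<in> h" "H \<noteq> 0" for H
  proof -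
    obtain w where w: "\<And>b. b \<in> B \<Longrightarrow> b \<in> wsp (w b)" using B(4) by metis
    have br_b: "br H b = w b H *\<^sub>R b" if "b \<in> B" for b
      using wspD[OF w[OF that] H(1)] .
    have eq: "\<kappa> H H = (\<Sum>b\<in>B. (w b H)\<^sup>2)"
      unfolding \<kappa>_def basis_trace_def
      by (rule sum.cong) (auto simp: br_b br_simps representation_scale representation_basis B
          span_base power2_eq_square)
    show ?thesis
    proof (rule ccontr)
      assume "\<not> ?thesis"
      then have "(\<Sum>b\<in>B. (w b H)\<^sup>2) = 0"
        unfolding eq using sum_nonneg[of B "\<lambda>b. (w b H)\<^sup>2"] by auto
      then have "\<And>b. b \<in> B \<Longrightarrow> w b H = 0" using B(1) by (simp add: sum_nonneg_eq_0_iff)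
      then have "br H x = 0" for x
        using linear_eq_0_on_span[OF linear_br, of B H x] br_b B(3) by auto
      then have "br x H = 0" for x using br_skew[of x H] by simp
      with H(2) show False using center_trivial by blast
    qed
  qed
  show ?thesis by (rule that[OF bil inv pos])
qed

text \<open>The radical of the Killing form is an ideal that misses \<open>H0\<close>, hence zero.
  So some weight vector \<open>y\<close> pairs nontrivially with \<open>e\<close>, and invariance
  forces its weight to be \<open>- l\<close>; a multiple of \<open>y\<close> is the desired
  \<open>f\<close>. The last conclusion, that all brackets of the root space with \<open>f\<close>
  lie on one line, prepares the proof that the root space itself is a line.\<close>

lemma sl2_triple_dual:
  assumes e: "e \<in> wsp l" "e \<noteq> 0" and l: "\<exists>H\<in>h. l H \<noteq> 0"
  obtains f where "f \<in> wsp (\<lambda>H. - l H)" "br e f \<in> h" "l (br e f) = 2"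
    "\<And>e'. e' \<in> wsp l \<Longrightarrow> br e' f = (l (br e' f) / 2) *\<^sub>R br e f"
proof -
  obtain \<kappa> :: "'v \<Rightarrow> 'v \<Rightarrow> real" where bil: "bilinear \<kappa>"
    and inv: "\<And>x y z. \<kappa> (br x y) z = \<kappa> x (br y z)"
    and pos: "\<And>H. H \<in> h \<Longrightarrow> H \<noteq> 0 \<Longrightarrow> \<kappa> H H > 0"
    by (rule invariant_form_exists) blast
  note ks = bilinear_ladd[OF bil] bilinear_radd[OF bil] bilinear_lmul[OF bil] bilinear_rmul[OF bil]
    bilinear_lzero[OF bil] bilinear_rzero[OF bil] bilinear_lsub[OF bil] bilinear_rsub[OF bil]
    bilinear_lneg[OF bil] bilinear_rneg[OF bil]
  obtain H0 where H0: "H0 \<in> h" "l H0 \<noteq> 0" using l by blast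
  have "{x. \<forall>y. \<kappa> x y = 0} = {0} \<or> {x. \<forall>y. \<kappa> x y = 0} = UNIV"
  proof (rule ideal_trivial)
    show "subspace {x. \<forall>y. \<kappa> x y = 0}" unfolding subspace_def by (auto simp: ks)
    fix x y assume "y \<in> {x. \<forall>y. \<kappa> x y = 0}"
    then have "\<kappa> (br y x) z = 0" for z by (simp add: inv)
    then show "br x y \<in> {x. \<forall>y. \<kappa> x y = 0}" using br_skew[of x y] by (simp add: ks)
  qed
  moreover have "H0 \<noteq> 0" using H0 e wspD[OF e(1), of 0] subspace_0[OF subspace_h]
    by (auto simp: br_simps)
  then have "\<kappa> H0 H0 \<noteq> 0" using pos H0 by force
  ultimately obtain y0 where "\<kappa> e y0 \<noteq> 0" using e(2) by blast
  then obtain m y where y: "y \<in> wsp m" "\<kappa> e y \<noteq> 0"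
    using linear_eq_0_on_span[of "\<kappa> e" "\<Union>l. wsp l" y0] bil span_weights
    unfolding bilinear_def by blast
  have m: "m H = - l H" if H: "H \<in> h" for H
  proof -
    have "\<kappa> (br H e) y = - \<kappa> (br e H) y" using br_skew[of H e] by (simp add: ks)
    also have "\<dots> = - \<kappa> e (br H y)" by (simp add: inv)
    finally have "(l H + m H) * \<kappa> e y = 0"
      by (simp add: wspD[OF e(1) H] wspD[OF y(1) H] ks algebra_simps)
    then show ?thesis using y(2) by simp
  qed
  have ym: "y \<in> wsp (\<lambda>H. - l H)" using y(1) wsp_cong[of m "\<lambda>H. - l H"] m by simp
  have brh: "br e' y \<in> h" if "e' \<in> wsp l" for e'
    using wsp_br[OF that ym] by (simp add: wsp_zero)
  have kH: "\<kappa> (br e' y) H = l H * \<kappa> e' y" if "e' \<in> wsp l" "H \<in> h" for e' H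
  proof -
    have "br y H = l H *\<^sub>R y" using br_skew[of y H] wspD[OF ym that(2)] by simp
    then show ?thesis by (simp add: inv ks)
  qed
  define t where "t = br e y"
  have t: "t \<in> h" unfolding t_def by (rule brh[OF e(1)])
  have "\<kappa> t H0 \<noteq> 0" unfolding t_def using kH[OF e(1) H0(1)] H0(2) y(2) by simp
  then have "t \<noteq> 0" by (auto simp: ks)
  then have "\<kappa> t t > 0" using pos t by blast
  \<comment> \<open>Here \<open>\<kappa> t t\<close> equals \<open>l t * \<kappa> e y\<close>, so
    definiteness on \<open>h\<close> excludes \<open>l t = 0\<close>, and \<open>y\<close> can be
    rescaled to reach the value 2.\<close>
  then have lt: "l t \<noteq> 0" using kH[OF e(1) t] t_def by auto
  have scale_l: "l (c *\<^sub>R H) = c * l H" if "H \<in> h" for c H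
    using wspD[OF e(1), of "c *\<^sub>R H"] wspD[OF e(1) that] e(2) subspace_scale[OF subspace_h that]
    by (simp add: br_simps)
  \<comment> \<open>By \<open>kH\<close> both sides have the same product with every element of
    \<open>h\<close>. Their difference lies in \<open>h\<close> and so has square zero.\<close>
  have scal: "br e' y = (\<kappa> e' y / \<kappa> e y) *\<^sub>R t" if e': "e' \<in> wsp l" for e'
  proof -
    define d where "d = br e' y - (\<kappa> e' y / \<kappa> e y) *\<^sub>R t"
    have d: "d \<in> h" unfolding d_def
      by (intro subspace_diff subspace_scale subspace_h brh e' t)
    have "\<kappa> d d = 0"
      using kH[OF e' d] kH[OF e(1) d] y(2) by (subst (1) d_def) (simp add: ks t_def[symmetric])
    then show ?thesis using pos[OF d] by (auto simp: d_def)
  qed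
  show ?thesis
  proof (rule that[of "(2 / l t) *\<^sub>R y"])
    show "(2 / l t) *\<^sub>R y \<in> wsp (\<lambda>H. - l H)" by (intro subspace_scale subspace_wsp ym)
    show "br e ((2 / l t) *\<^sub>R y) \<in> h" using t t_def subspace_h by (simp add: br_simps subspace_scale)
    show "l (br e ((2 / l t) *\<^sub>R y)) = 2" using lt t by (simp add: br_simps t_def[symmetric] scale_l)
    fix e' assume "e' \<in> wsp l"
    from scal[OF this] show "br e' ((2 / l t) *\<^sub>R y) =
        (l (br e' ((2 / l t) *\<^sub>R y)) / 2) *\<^sub>R br e ((2 / l t) *\<^sub>R y)"
      using t lt by (simp add: br_simps t_def[symmetric] scale_l mult.commute)
  qed
qed

text \<open>From \<open>e'\<close> subtract the multiple of \<open>e\<close> that makes the bracket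
  with \<open>f\<close> vanish. The difference \<open>d\<close> commutes with \<open>f\<close>, and
  with \<open>e\<close> because twice the root is no weight, so it commutes with
  \<open>br e f\<close>. But \<open>br e f\<close> multiplies \<open>d\<close> by 2.\<close>

lemma wsp_one_dim:
  assumes e: "e \<in> wsp l" "e \<noteq> 0" and l: "\<exists>H\<in>h. l H \<noteq> 0" and l2: "wsp (\<lambda>H. l H + l H) = {0}"
  shows "wsp l = span {e}"
proof -
  obtain f where f: "f \<in> wsp (\<lambda>H. - l H)" "br e f \<in> h" "l (br e f) = 2"
    "\<And>e'. e' \<in> wsp l \<Longrightarrow> br e' f = (l (br e' f) / 2) *\<^sub>R br e f"
    using sl2_triple_dual[OF e l] by blast
  have "e' \<in> span {e}" if e': "e' \<in> wsp l" for e'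
  proof -
    define d where "d = e' - (l (br e' f) / 2) *\<^sub>R e"
    have d: "d \<in> wsp l" unfolding d_def by (intro subspace_diff subspace_scale subspace_wsp e' e)
    have df: "br d f = 0" using f(4)[OF e'] by (simp add: d_def br_simps)
    have de: "br d e = 0" using wsp_br[OF d e(1)] l2 by auto
    have "br d (br e f) = 0" using jacobi[of d e f] df de by (simp add: br_simps)
    moreover have "br (br e f) d = 2 *\<^sub>R d" using wspD[OF d f(2)] f(3) by simp
    ultimately have "d = 0" using br_skew[of d "br e f"] by simp
    then show ?thesis by (auto simp: d_def span_singleton)
  qed
  moreover have "span {e} \<subseteq> wsp l" using e(1) by (intro span_minimal subspace_wsp) auto
  ultimately show ?thesis by blast
qed

end

section \<open>Strings of an sl2-triple\<close>

context split_simple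
begin

text \<open>Weights are mere functions; a nonzero weight vector forces them to be linear on
  \<open>h\<close>.\<close>

lemma weight_linear:
  assumes "X \<in> wsp l" "X \<noteq> 0" "H \<in> h" "K \<in> h"
  shows "l (a *\<^sub>R H + b *\<^sub>R K) = a * l H + b * l K"
proof -
  have "a *\<^sub>R H + b *\<^sub>R K \<in> h"
    by (intro subspace_add subspace_scale subspace_h assms)
  from wspD[OF assms(1) this] have "l (a *\<^sub>R H + b *\<^sub>R K) *\<^sub>R X = (a * l H + b * l K) *\<^sub>R X"
    by (simp add: br_simps wspD[OF assms(1)] assms(3,4) scaleR_add_left)
  then show ?thesis using assms(2) by simp
qed

text \<open>For a lowest weight vector \<open>y\<close>, applying \<open>f\<close> to the
  \<open>k\<close>-th power of \<open>br e\<close> on \<open>y\<close> gives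
  \<open>- k * (w + k - 1)\<close> times the previous power. If \<open>k\<close> is the last step
  with a nonzero result, this factor vanishes for \<open>k + 1\<close>, so
  \<open>w = - k\<close>.\<close>

lemma sl2_string:
  assumes t: "br e f = t" "br t e = 2 *\<^sub>R e" and y: "br t y = w *\<^sub>R y" "br f y = 0" "y \<noteq> 0"
    and e4: "br e (br e (br e (br e y))) = 0"
  shows "w \<in> {0, -1, -2, -3}" "w = -3 \<Longrightarrow> br e (br e (br e y)) \<noteq> 0"
proof -
  have f_e: "br f (br e v) = br e (br f v) - br t v" for v
    using jacobi[of e f v] t(1) by (simp add: algebra_simps)
  have t_e: "br t (br e v) = 2 *\<^sub>R br e v + br e (br t v)" for v
    using jacobi[of t e v] t(2) by (simp add: br_simps)
  have t1: "br t (br e y) = (w + 2) *\<^sub>R br e y"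
    by (simp add: t_e y br_simps scaleR_add_left)
  have t2: "br t (br e (br e y)) = (w + 4) *\<^sub>R br e (br e y)"
    unfolding t_e[of "br e y"] t1 by (simp add: br_simps flip: scaleR_add_left)
  have t3: "br t (br e (br e (br e y))) = (w + 6) *\<^sub>R br e (br e (br e y))"
    unfolding t_e[of "br e (br e y)"] t2 by (simp add: br_simps flip: scaleR_add_left)
  have f1: "br f (br e y) = (- w) *\<^sub>R y"
    by (simp add: f_e y br_simps)
  have f2: "br f (br e (br e y)) = (- 2 * w - 2) *\<^sub>R br e y"
    unfolding f_e[of "br e y"] f1 t1 br_simps
    by (simp only: flip: scaleR_left_diff_distrib) simp
  have f3: "br f (br e (br e (br e y))) = (- 3 * w - 6) *\<^sub>R br e (br e y)"
    unfolding f_e[of "br e (br e y)"] f2 t2 br_simps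
    by (simp only: flip: scaleR_left_diff_distrib) simp
  have f4: "br f (br e (br e (br e (br e y)))) = (- 4 * w - 12) *\<^sub>R br e (br e (br e y))"
    unfolding f_e[of "br e (br e (br e y))"] f3 t3 br_simps
    by (simp only: flip: scaleR_left_diff_distrib) simp
  have c4: "w = -3 \<or> br e (br e (br e y)) = 0" using f4 e4 by (auto simp: br_simps)
  have c3: "br e (br e (br e y)) = 0 \<Longrightarrow> w = -2 \<or> br e (br e y) = 0"
    using f3 by (auto simp: br_simps)
  have c2: "br e (br e y) = 0 \<Longrightarrow> w = -1 \<or> br e y = 0"
    using f2 by (auto simp: br_simps)
  have c1: "br e y = 0 \<Longrightarrow> w = 0"
    using f1 y(3) by (auto simp: br_simps)
  show "w \<in> {0, -1, -2, -3}" using c1 c2 c3 c4 by blast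
  show "w = -3 \<Longrightarrow> br e (br e (br e y)) \<noteq> 0" using c1 c2 c3 by force
qed

end

section \<open>Root spaces of the split algebra of type G2\<close>

locale split_G2_algebra =
  fixes br :: "'v::euclidean_space \<Rightarrow> 'v \<Rightarrow> 'v" and h :: "'v set" and \<alpha> \<beta> :: "'v \<Rightarrow> real"
  assumes G2: "split_G2 br h \<alpha> \<beta>"
begin

sublocale split_simple br h
  by unfold_locales (use G2 in \<open>auto simp: split_G2_def\<close>)

abbreviation rt :: "int \<Rightarrow> int \<Rightarrow> 'v \<Rightarrow> real" where "rt a b \<equiv> lincomb \<alpha> \<beta> (a, b)"

abbreviation rsp :: "int \<Rightarrow> int \<Rightarrow> 'v set" where "rsp a b \<equiv> wsp (rt a b)"

lemma rt: "rt a b H = of_int a * \<alpha> H + of_int b * \<beta> H"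
  by (simp add: lincomb_def)

lemma independent_simple: "(\<And>H. H \<in> h \<Longrightarrow> a * \<alpha> H + b * \<beta> H = 0) \<Longrightarrow> a = 0 \<and> b = 0"
  using G2 unfolding split_G2_def by blast

lemma roots_eq: "roots br h = (\<lambda>p. restrict (lincomb \<alpha> \<beta> p) h) ` G2_coords"
  using G2 unfolding split_G2_def by blast

lemma rt_nonzero: "(a, b) \<noteq> (0, 0) \<Longrightarrow> \<exists>H\<in>h. rt a b H \<noteq> 0"
  using independent_simple[of "of_int a" "of_int b"] by (auto simp: rt)

lemma wsp_restrict: "wsp (restrict l h) = wsp l"
  by (rule wsp_cong) simp

lemma rsp_nontrivial: "(a, b) \<in> G2_coords \<Longrightarrow> rsp a b \<noteq> {0}"
proof -
  assume "(a, b) \<in> G2_coords"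
  then have "restrict (rt a b) h \<in> roots br h" unfolding roots_eq by blast
  then show ?thesis unfolding roots_def by (simp add: wsp_restrict)
qed

lemma rsp_nonzeroE:
  assumes "(a, b) \<in> G2_coords"
  obtains x where "x \<in> rsp a b" "x \<noteq> 0"
  using rsp_nontrivial[OF assms] subspace_0[OF subspace_wsp] by blast

text \<open>Independence of \<alpha> and \<beta> makes the coordinates of a weight unique, so
  coordinates outside \<open>G2_coords\<close> cannot describe a root in another way.\<close>

lemma rsp_nonroot:
  assumes "(a, b) \<notin> G2_coords" "(a, b) \<noteq> (0, 0)"
  shows "rsp a b = {0}"
proof (rule ccontr)
  assume *: "rsp a b \<noteq> {0}"
  have "restrict (rt a b) h \<in> roots br h"
    unfolding roots_def using * rt_nonzero[OF assms(2)] by (auto simp: wsp_restrict)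
  then obtain c d where cd: "(c, d) \<in> G2_coords" "restrict (rt a b) h = restrict (rt c d) h"
    unfolding roots_eq by auto
  have "(of_int a - of_int c) * \<alpha> H + (of_int b - of_int d) * \<beta> H = 0" if "H \<in> h" for H
    using fun_cong[OF cd(2), of H] that by (simp add: rt algebra_simps)
  then have "real_of_int a - of_int c = 0 \<and> real_of_int b - of_int d = 0"
    by (rule independent_simple)
  then show False using cd(1) assms(1) by simp
qed

lemma rsp_br:
  assumes "x \<in> rsp a b" "y \<in> rsp c d"
  shows "br x y \<in> rsp (a + c) (b + d)"
proof -
  have "(\<lambda>H. rt a b H + rt c d H) = rt (a + c) (b + d)"
    by (simp add: fun_eq_iff rt algebra_simps)
  then show ?thesis using wsp_br[OF assms] by simp
qed

lemma rsp_br_zero: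
  assumes "x \<in> rsp a b" "y \<in> rsp c d" "(a + c, b + d) \<notin> G2_coords" "(a + c, b + d) \<noteq> (0, 0)"
  shows "br x y = 0"
  using rsp_br[OF assms(1,2)] rsp_nonroot[OF assms(3,4)] by simp

lemma rsp_0: "rsp 0 0 = h"
proof -
  have "rt 0 0 = (\<lambda>H. 0)" by (simp add: fun_eq_iff rt)
  then show ?thesis using wsp_zero by simp
qed

text \<open>Twice a root of G2 is neither a root nor zero, so \<open>wsp_one_dim\<close>
  applies.\<close>

lemma rsp_span:
  assumes "(a, b) \<in> G2_coords" "x \<in> rsp a b" "x \<noteq> 0"
  shows "rsp a b = span {x}"
proof (rule wsp_one_dim)
  have ne: "(a, b) \<noteq> (0, 0)" using assms(1) by (auto simp: G2_coords_def)
  show "\<exists>H\<in>h. rt a b H \<noteq> 0" by (rule rt_nonzero[OF ne])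
  have "(a + a, b + b) \<notin> G2_coords" "(a + a, b + b) \<noteq> (0, 0)"
    using assms(1) by (auto simp: G2_coords_def)
  moreover have "(\<lambda>H. rt a b H + rt a b H) = rt (a + a) (b + b)"
    by (simp add: fun_eq_iff rt algebra_simps)
  ultimately show "wsp (\<lambda>H. rt a b H + rt a b H) = {0}"
    using rsp_nonroot by simp
qed fact+

text \<open>Both simple roots are linear on \<open>h\<close> because root vectors exist.
  Independence, used for \<alpha> alone and then for the coefficients \<open>- \<beta> H\<close> and
  \<open>\<alpha> H\<close>, yields \<open>H\<close> and \<open>K\<close> with nonzero determinant
  \<open>D\<close>; the rest is Cramer's rule.\<close>

lemma simple_values_exist:
  obtains H where "H \<in> h" "\<alpha> H = a" "\<beta> H = b"
proof -
  obtain X where X: "X \<in> rsp 1 0" "X \<noteq> 0" by (rule rsp_nonzeroE[of 1 0]) (auto simp: G2_coords_def)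
  obtain Y where Y: "Y \<in> rsp 0 1" "Y \<noteq> 0" by (rule rsp_nonzeroE[of 0 1]) (auto simp: G2_coords_def)
  have lin: "\<alpha> (c *\<^sub>R H + d *\<^sub>R K) = c * \<alpha> H + d * \<alpha> K" "\<beta> (c *\<^sub>R H + d *\<^sub>R K) = c * \<beta> H + d * \<beta> K"
    if "H \<in> h" "K \<in> h" for c d H K
    using weight_linear[OF X that] weight_linear[OF Y that] by (simp_all add: rt)
  obtain H where H: "H \<in> h" "\<alpha> H \<noteq> 0" using independent_simple[of 1 0] by auto
  obtain K where K: "K \<in> h" "- \<beta> H * \<alpha> K + \<alpha> H * \<beta> K \<noteq> 0"
    using independent_simple[of "- \<beta> H" "\<alpha> H"] H(2) by auto
  define D where "D = - \<beta> H * \<alpha> K + \<alpha> H * \<beta> K"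
  have D: "D \<noteq> 0" using K(2) by (simp add: D_def)
  define M where "M = ((a * \<beta> K - b * \<alpha> K) / D) *\<^sub>R H + ((b * \<alpha> H - a * \<beta> H) / D) *\<^sub>R K"
  have "M \<in> h" unfolding M_def by (intro subspace_add subspace_scale subspace_h H K)
  moreover have "\<alpha> M = a" "\<beta> M = b"
    unfolding M_def lin[OF H(1) K(1)] using D by (simp_all add: field_simps) (simp_all add: D_def algebra_simps)
  ultimately show ?thesis by (rule that)
qed

text \<open>Let \<open>x\<close> and \<open>y\<close> be root vectors at the two ends of the
  \<alpha>-string from \<open>- 3 \<alpha> - \<beta>\<close> to \<open>- \<beta>\<close>. Each is a
  lowest weight vector, for the triple of \<open>e\<close> or for the reversed one, so
  \<open>- 6 - \<beta> t\<close> and \<open>\<beta> t\<close> are both at least -3. They add up to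
  -6, so both are -3 and the string from \<open>x\<close> takes three nonzero steps.\<close>

lemma short_string:
  obtains e x where "e \<in> rsp 1 0" "e \<noteq> 0" "x \<in> rsp (-3) (-1)" "br e (br e (br e x)) \<noteq> 0"
proof -
  obtain e where e: "e \<in> rsp 1 0" "e \<noteq> 0" by (rule rsp_nonzeroE[of 1 0]) (auto simp: G2_coords_def)
  obtain f where f: "f \<in> wsp (\<lambda>H. - rt 1 0 H)" "br e f \<in> h" "rt 1 0 (br e f) = 2"
    using sl2_triple_dual[OF e] rt_nonzero[of 1 0] by auto
  define t where "t = br e f"
  have t: "t \<in> h" "\<alpha> t = 2" using f by (simp_all add: t_def rt)
  have f': "f \<in> rsp (-1) 0"
    using f(1) wsp_cong[of "\<lambda>H. - rt 1 0 H" "rt (-1) 0"] by (simp add: rt)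
  obtain x where x: "x \<in> rsp (-3) (-1)" "x \<noteq> 0"
    by (rule rsp_nonzeroE[of "-3" "-1"]) (auto simp: G2_coords_def)
  obtain y where y: "y \<in> rsp 0 (-1)" "y \<noteq> 0"
    by (rule rsp_nonzeroE[of 0 "-1"]) (auto simp: G2_coords_def)
  have te: "br t e = 2 *\<^sub>R e" "br t f = - (2 *\<^sub>R f)"
    using wspD[OF e(1) t(1)] wspD[OF f' t(1)] t(2) by (simp_all add: rt)
  have up: "br e v \<in> rsp (a + 1) b" if "v \<in> rsp a b" for v a b
    using rsp_br[OF e(1) that] by (simp add: add.commute)
  have down: "br f v \<in> rsp (a - 1) b" if "v \<in> rsp a b" for v a b
    using rsp_br[OF f' that] by simp
  have "rsp 1 (-1) = {0}" "rsp (-4) (-1) = {0}" by (auto simp: rsp_nonroot G2_coords_def)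
  then have ends: "br f x = 0" "br e y = 0" "br e (br e (br e (br e x))) = 0"
      "br f (br f (br f (br f y))) = 0"
    using down[OF x(1)] up[OF y(1)] up[OF up[OF up[OF up[OF x(1)]]]]
      down[OF down[OF down[OF down[OF y(1)]]]] by auto
  have tx: "br t x = (- 6 - \<beta> t) *\<^sub>R x" "br (- t) y = \<beta> t *\<^sub>R y"
    using wspD[OF x(1) t(1)] wspD[OF y(1) t(1)] t(2) by (simp_all add: rt br_simps)
  \<comment> \<open>Exchanging \<open>e\<close> and \<open>f\<close> and replacing \<open>t\<close>
    by \<open>- t\<close> gives the reversed triple, for which the upper end \<open>y\<close> is
    lowest.\<close>
  have fe: "br f e = - t" "br (- t) f = 2 *\<^sub>R f"
    using br_skew[of e f] te(2) by (simp_all add: t_def br_simps)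
  have "\<beta> t \<in> {0, -1, -2, -3}"
    by (rule sl2_string(1)[OF fe tx(2) ends(2) y(2) ends(4)])
  moreover have "- 6 - \<beta> t \<in> {0, -1, -2, -3}"
    by (rule sl2_string(1)[OF t_def[symmetric] te(1) tx(1) ends(1) x(2) ends(3)])
  ultimately have "- 6 - \<beta> t = -3" by auto
  then have "br e (br e (br e x)) \<noteq> 0"
    by (rule sl2_string(2)[OF t_def[symmetric] te(1) tx(1) ends(1) x(2) ends(3)])
  then show ?thesis using that e x by blast
qed

text \<open>Suppose \<open>x\<close> and \<open>y\<close> commute, and let \<open>t = br x f\<close>
  for a partner \<open>f\<close> of \<open>x\<close>. Since \<open>f\<close> also kills
  \<open>y\<close>, so does \<open>t\<close>. On a root vector \<open>v\<close> of
  \<open>- 3 \<alpha> - 2 \<beta>\<close>, \<open>x\<close> vanishes and \<open>f\<close> leads into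
  the line of \<open>y\<close>, so \<open>t\<close> kills \<open>v\<close> too. The difference of
  the two weights gives \<open>\<beta> t = 0\<close>, whereas \<open>\<beta> t = -2\<close>.\<close>

lemma highest_bracket_nonzero:
  assumes x: "x \<in> rsp 0 (-1)" "x \<noteq> 0" and y: "y \<in> rsp (-3) (-1)" "y \<noteq> 0"
  shows "br x y \<noteq> 0"
proof
  assume xy: "br x y = 0"
  obtain f where f: "f \<in> wsp (\<lambda>H. - rt 0 (-1) H)" "br x f \<in> h" "rt 0 (-1) (br x f) = 2"
    using sl2_triple_dual[OF x] rt_nonzero[of 0 "-1"] by auto
  define t where "t = br x f"
  have t: "t \<in> h" "\<beta> t = -2" using f by (simp_all add: t_def rt)
  have f': "f \<in> rsp 0 1"
    using f(1) wsp_cong[of "\<lambda>H. - rt 0 (-1) H" "rt 0 1"] by (simp add: rt)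
  obtain v where v: "v \<in> rsp (-3) (-2)" "v \<noteq> 0"
    by (rule rsp_nonzeroE[of "-3" "-2"]) (auto simp: G2_coords_def)
  have br_t: "br t w = br x (br f w) - br f (br x w)" for w
    using jacobi[of x f w] by (simp add: t_def)
  have "br f y = 0" using rsp_br_zero[OF f' y(1)] by (simp add: G2_coords_def)
  then have "br t y = 0" by (simp add: br_t xy br_simps)
  then have "rt (-3) (-1) t = 0" using wspD[OF y(1) t(1)] y(2) by simp
  moreover have "br x v = 0" using rsp_br_zero[OF x(1) v(1)] by (simp add: G2_coords_def)
  have "br f v \<in> rsp (-3) (-1)" using rsp_br[OF f' v(1)] by simp
  then have "br f v \<in> span {y}" using rsp_span[OF _ y] by (simp add: G2_coords_def)
  then have "br x (br f v) = 0" by (auto simp: span_singleton br_simps xy)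
  then have "br t v = 0" using \<open>br x v = 0\<close> by (simp add: br_t br_simps)
  then have "rt (-3) (-2) t = 0" using wspD[OF v(1) t(1)] v(2) by simp
  ultimately show False using t(2) by (simp add: rt)
qed

end

section \<open>Cochains of a graded Lie algebra\<close>

locale graded_lie =
  fixes br :: "'v::real_vector \<Rightarrow> 'v \<Rightarrow> 'v" and q :: "int \<Rightarrow> 'v set"
  assumes bil: "bilinear br"
    and jac: "br x (br y z) = br (br x y) z + br y (br x z)"
    and subspace_q: "subspace (q i)"
    and neg_br: "x \<in> neg_part q \<Longrightarrow> y \<in> neg_part q \<Longrightarrow> br x y \<in> neg_part q"
begin

lemmas bs = bilinear_ladd[OF bil] bilinear_radd[OF bil] bilinear_lmul[OF bil] bilinear_rmul[OF bil]
  bilinear_lsub[OF bil] bilinear_rsub[OF bil] bilinear_lzero[OF bil] bilinear_rzero[OF bil]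
  bilinear_lneg[OF bil] bilinear_rneg[OF bil]

lemma subspace_neg_part: "subspace (neg_part q)" and subspace_whole: "subspace (whole q)"
  and subspace_filt: "subspace (filt q k)"
  unfolding neg_part_def whole_def filt_def by simp_all

lemmas q_mem = subspace_0[OF subspace_q] subspace_add[OF subspace_q] subspace_diff[OF subspace_q]
  subspace_scale[OF subspace_q]

lemmas neg_mem = subspace_0[OF subspace_neg_part] subspace_add[OF subspace_neg_part]
  subspace_diff[OF subspace_neg_part] subspace_scale[OF subspace_neg_part]

lemmas whole_mem = subspace_0[OF subspace_whole] subspace_add[OF subspace_whole]
  subspace_diff[OF subspace_whole] subspace_scale[OF subspace_whole]

lemmas filt_mem = subspace_0[OF subspace_filt] subspace_add[OF subspace_filt]
  subspace_diff[OF subspace_filt] subspace_scale[OF subspace_filt]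

lemma q_neg: "a < 0 \<Longrightarrow> x \<in> q a \<Longrightarrow> x \<in> neg_part q"
  unfolding neg_part_def by (rule span_base) blast

lemma q_filt: "k \<le> a \<Longrightarrow> x \<in> q a \<Longrightarrow> x \<in> filt q k"
  unfolding filt_def by (rule span_base) auto

lemma q_whole: "x \<in> q a \<Longrightarrow> x \<in> whole q"
  unfolding whole_def by (rule span_base) blast

lemma neg_whole: "x \<in> neg_part q \<Longrightarrow> x \<in> whole q"
  unfolding neg_part_def whole_def by (rule subsetD[OF span_mono]) auto

lemma filt_whole: "x \<in> filt q k \<Longrightarrow> x \<in> whole q"
  unfolding filt_def whole_def by (rule subsetD[OF span_mono]) auto

text \<open>This is what the cochain calculus uses of an element of \<open>q 0\<close>: it then also
  preserves the negative part, the whole algebra and the filtration.\<close>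

definition degree0 :: "'v \<Rightarrow> bool" where
  "degree0 A \<longleftrightarrow> (\<forall>a. \<forall>x\<in>q a. br A x \<in> q a)"

lemma degree0_q: "degree0 A \<Longrightarrow> x \<in> q a \<Longrightarrow> br A x \<in> q a"
  unfolding degree0_def by blast

lemma degree0_span:
  assumes "degree0 A" "x \<in> span (\<Union>i\<in>I. q i)"
  shows "br A x \<in> span (\<Union>i\<in>I. q i)"
proof -
  have lin: "linear (br A)" using bil unfolding bilinear_def by blast
  have "br A ` span (\<Union>i\<in>I. q i) \<subseteq> span (\<Union>i\<in>I. q i)"
    unfolding linear_span_image[OF lin, symmetric]
    by (rule span_minimal[OF _ subspace_span])
      (auto intro!: span_base dest: degree0_q[OF assms(1)])
  then show ?thesis using assms(2) by blast
qed

lemma degree0_neg: "degree0 A \<Longrightarrow> x \<in> neg_part q \<Longrightarrow> br A x \<in> neg_part q"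
  unfolding neg_part_def by (rule degree0_span)

lemma degree0_whole: "degree0 A \<Longrightarrow> x \<in> whole q \<Longrightarrow> br A x \<in> whole q"
  unfolding whole_def by (rule degree0_span)

lemma degree0_filt: "degree0 A \<Longrightarrow> x \<in> filt q k \<Longrightarrow> br A x \<in> filt q k"
  unfolding filt_def by (rule degree0_span)

lemma homogeneous1_iff:
  "f \<in> homogeneous1 q i \<longleftrightarrow>
     (\<forall>x\<in>neg_part q. f x \<in> whole q) \<and>
     (\<forall>x\<in>neg_part q. \<forall>y\<in>neg_part q. f (x + y) = f x + f y) \<and>
     (\<forall>c. \<forall>x\<in>neg_part q. f (c *\<^sub>R x) = c *\<^sub>R f x) \<and>
     (\<forall>x. x \<notin> neg_part q \<longrightarrow> f x = 0) \<and>
     (\<forall>a<0. \<forall>x\<in>q a. f x \<in> q (a + i))"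
  unfolding homogeneous1_def cochains1_def linear_into_def by blast

lemma homogeneous1D:
  assumes "f \<in> homogeneous1 q i"
  shows "x \<in> neg_part q \<Longrightarrow> f x \<in> whole q"
    "x \<in> neg_part q \<Longrightarrow> y \<in> neg_part q \<Longrightarrow> f (x + y) = f x + f y"
    "x \<in> neg_part q \<Longrightarrow> f (c *\<^sub>R x) = c *\<^sub>R f x"
    "x \<notin> neg_part q \<Longrightarrow> f x = 0"
    "a < 0 \<Longrightarrow> x \<in> q a \<Longrightarrow> f x \<in> q (a + i)"
  using assms unfolding homogeneous1_iff by blast+

lemma subspace_homogeneous1: "subspace (homogeneous1 q i)"
proof (rule subspaceI)
  show "0 \<in> homogeneous1 q i"
    by (simp add: homogeneous1_iff q_mem whole_mem)
  fix f assume f: "f \<in> homogeneous1 q i"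
  note fs = homogeneous1D[OF f]
  show "c *\<^sub>R f \<in> homogeneous1 q i" for c
    unfolding homogeneous1_iff by (simp add: scaleR_fun_def fs q_mem whole_mem scaleR_add_right)
  fix g assume g: "g \<in> homogeneous1 q i"
  note gs = homogeneous1D[OF g]
  show "f + g \<in> homogeneous1 q i"
    unfolding homogeneous1_iff by (simp add: fs gs q_mem whole_mem scaleR_add_right)
qed

lemma coboundary_diff: "coboundary br q (f - g) = coboundary br q f - coboundary br q g"
  by (intro ext) (simp add: coboundary_def bs)

lemma coboundary_image_diff:
  assumes "u \<in> coboundary br q ` homogeneous1 q i" "v \<in> coboundary br q ` homogeneous1 q i"
  shows "u - v \<in> coboundary br q ` homogeneous1 q i"
proof -
  obtain f g where "f \<in> homogeneous1 q i" "g \<in> homogeneous1 q i"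
      "u = coboundary br q f" "v = coboundary br q g"
    using assms by blast
  then have "u - v = coboundary br q (f - g)" "f - g \<in> homogeneous1 q i"
    by (auto simp: coboundary_diff intro: subspace_diff[OF subspace_homogeneous1])
  then show ?thesis by blast
qed

text \<open>The differential is equivariant: for the transformed cochain \<open>g\<close>, the
  Jacobi identity identifies the action of \<open>A\<close> on the coboundary of \<open>f\<close>
  with the coboundary of \<open>g\<close>. Since \<open>A\<close> preserves degrees,
  \<open>g\<close> is again homogeneous of degree \<open>i\<close>.\<close>

lemma inf_action_coboundary:
  assumes A: "degree0 A" and f: "f \<in> homogeneous1 q i"
  shows "inf_action br q A (coboundary br q f) \<in> coboundary br q ` homogeneous1 q i"
proof -
  note fs = homogeneous1D[OF f]
  note As = degree0_neg[OF A] degree0_whole[OF A] degree0_q[OF A]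
  define g where "g x = (if x \<in> neg_part q then br A (f x) - f (br A x) else 0)" for x
  show ?thesis
  proof (rule image_eqI)
    show "g \<in> homogeneous1 q i"
      unfolding homogeneous1_iff
      by (auto simp: g_def neg_mem fs As whole_mem q_mem bs q_neg scaleR_diff_right)
    show "inf_action br q A (coboundary br q f) = coboundary br q g"
    proof (intro ext)
      fix x y
      show "inf_action br q A (coboundary br q f) x y = coboundary br q g x y"
      proof (cases "x \<in> neg_part q \<and> y \<in> neg_part q")
        case True
        then have "f (br A (br x y)) = f (br (br A x) y) + f (br x (br A y))"
          using jac[of A x y] fs(2) As(1) neg_br by simp
        with True show ?thesis
          by (simp add: inf_action_def coboundary_def g_def neg_br As(1) bs jac[of A])
      qed (auto simp: inf_action_def coboundary_def)
    qed
  qed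
qed

end

section \<open>No invariant complement in degree one\<close>

context split_G2_algebra
begin

abbreviation "q \<equiv> q_grade br h \<alpha> \<beta>"

text \<open>Letting \<open>a\<close> run over all integers adds only zero spaces, and for
  \<open>i = 0\<close> it absorbs \<open>h\<close> as the weight space of 0. In this form closure
  under the bracket needs no inspection of the root list.\<close>

lemma contact_grade_eq: "contact_grade br h \<alpha> \<beta> i = span (\<Union>a. rsp a i)"
proof (rule antisym)
  show "contact_grade br h \<alpha> \<beta> i \<subseteq> span (\<Union>a. rsp a i)"
    unfolding contact_grade_def using rsp_0 by (intro span_mono) (auto split: if_splits)
  have "rsp a i \<subseteq> contact_grade br h \<alpha> \<beta> i" for a
  proof -
    consider "(a, i) \<in> G2_coords" | "(a, i) = (0, 0)" | "rsp a i = {0}"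
      using rsp_nonroot by blast
    then show ?thesis
    proof cases
      case 1
      then show ?thesis unfolding contact_grade_def by (intro subsetI span_base) auto
    next
      case 2
      then show ?thesis unfolding contact_grade_def using rsp_0 by (intro subsetI span_base) auto
    next
      case 3
      then show ?thesis unfolding contact_grade_def by (simp add: span_zero)
    qed
  qed
  then show "span (\<Union>a. rsp a i) \<subseteq> contact_grade br h \<alpha> \<beta> i"
    by (intro span_minimal UN_least) (simp_all add: contact_grade_def)
qed

lemma rsp_contact: "x \<in> rsp a i \<Longrightarrow> x \<in> contact_grade br h \<alpha> \<beta> i"
  unfolding contact_grade_eq by (rule span_base) blast

lemma subspace_contact: "subspace (contact_grade br h \<alpha> \<beta> i)"
  by (simp add: contact_grade_def)

lemma contact_br:
  assumes "x \<in> contact_grade br h \<alpha> \<beta> i" "y \<in> contact_grade br h \<alpha> \<beta> j"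
  shows "br x y \<in> contact_grade br h \<alpha> \<beta> (i + j)"
proof (rule bilinear_span_mem[OF bilinear_br subspace_contact])
  fix x y assume "x \<in> (\<Union>a. rsp a i)" "y \<in> (\<Union>a. rsp a j)"
  then show "br x y \<in> contact_grade br h \<alpha> \<beta> (i + j)"
    using rsp_br rsp_contact by blast
qed (use assms in \<open>auto simp: contact_grade_eq\<close>)

lemma borel_eq: "borel_g0 br h \<alpha> = span (rsp 0 0 \<union> rsp 1 0)"
  unfolding borel_g0_def rsp_0 using wsp_cong[of \<alpha> "rt 1 0"] by (simp add: rt)

lemma borel_contact: "x \<in> borel_g0 br h \<alpha> \<Longrightarrow> x \<in> contact_grade br h \<alpha> \<beta> 0"
  unfolding borel_eq contact_grade_eq by (rule subsetD[OF span_mono]) auto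

text \<open>The only bracket that could leave the Borel subalgebra has weight
  \<open>2 \<alpha>\<close>, which is not a root.\<close>

lemma borel_br:
  assumes "x \<in> borel_g0 br h \<alpha>" "y \<in> borel_g0 br h \<alpha>"
  shows "br x y \<in> borel_g0 br h \<alpha>"
proof (rule bilinear_span_mem[OF bilinear_br])
  show "subspace (borel_g0 br h \<alpha>)" by (simp add: borel_g0_def)
  have "rsp 2 0 = {0}" by (rule rsp_nonroot) (auto simp: G2_coords_def)
  fix x y assume "x \<in> rsp 0 0 \<union> rsp 1 0" "y \<in> rsp 0 0 \<union> rsp 1 0"
  then have "br x y \<in> rsp 0 0 \<union> rsp 1 0 \<union> rsp 2 0"
    using rsp_br[of x 0 0 y 0 0] rsp_br[of x 0 0 y 1 0] rsp_br[of x 1 0 y 0 0] rsp_br[of x 1 0 y 1 0]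
    by auto
  then show "br x y \<in> borel_g0 br h \<alpha>"
    unfolding borel_eq \<open>rsp 2 0 = {0}\<close> by (auto intro: span_base span_zero)
qed (use assms in \<open>auto simp: borel_eq\<close>)

lemma subspace_q_grade: "subspace (q i)"
proof -
  have "subspace {X \<in> contact_grade br h \<alpha> \<beta> 1.
      \<forall>Y\<in>contact_grade br h \<alpha> \<beta> (-1). br X Y \<in> borel_g0 br h \<alpha>}"
    using subspace_contact[of 1] unfolding subspace_def borel_g0_def
    by (auto simp: br_simps span_zero span_add span_scale)
  then show ?thesis
    using subspace_contact by (simp add: q_grade_def borel_g0_def subspace_single_0)
qed

text \<open>Only degree 1 needs an argument: writing \<open>br (br A x) y\<close> as
  \<open>br A (br x y) - br x (br A y)\<close>, both terms lie in the Borel subalgebra, as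
  \<open>br A y\<close> is again of degree -1.\<close>

lemma q_br:
  assumes A: "A \<in> q 0" and x: "x \<in> q i"
  shows "br A x \<in> q i"
proof -
  have A': "A \<in> borel_g0 br h \<alpha>" using A by (simp add: q_grade_def)
  note A0 = borel_contact[OF A']
  consider "i < 0" | "i = 0" | "i = 1" | "i > 1" by linarith
  then show ?thesis
  proof cases
    case 1
    then show ?thesis using contact_br[OF A0, of x i] x by (simp add: q_grade_def)
  next
    case 2
    then show ?thesis using borel_br[OF A'] x by (simp add: q_grade_def)
  next
    case 3
    with x have x1: "x \<in> contact_grade br h \<alpha> \<beta> 1"
      and x2: "\<And>y. y \<in> contact_grade br h \<alpha> \<beta> (-1) \<Longrightarrow> br x y \<in> borel_g0 br h \<alpha>"
      by (auto simp: q_grade_def)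
    have "br (br A x) y \<in> borel_g0 br h \<alpha>" if y: "y \<in> contact_grade br h \<alpha> \<beta> (-1)" for y
    proof -
      have "br (br A x) y = br A (br x y) - br x (br A y)"
        using jacobi[of A x y] by simp
      moreover have "br A y \<in> contact_grade br h \<alpha> \<beta> (-1)" using contact_br[OF A0 y] by simp
      moreover have "subspace (borel_g0 br h \<alpha>)" by (simp add: borel_g0_def)
      ultimately show ?thesis
        using x2 borel_br[OF A'] y by (simp add: subspace_diff)
    qed
    then show ?thesis using 3 contact_br[OF A0 x1] by (simp add: q_grade_def)
  next
    case 4
    then show ?thesis using x by (simp add: q_grade_def br_simps)
  qed
qed

sublocale graded_lie br q
proof
  show "bilinear br" by (rule bilinear_br)
  show "br x (br y z) = br (br x y) z + br y (br x z)" for x y z by (rule jacobi)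
  show "subspace (q i)" for i by (rule subspace_q_grade)
  fix x y assume xy: "x \<in> neg_part q" "y \<in> neg_part q"
  show "br x y \<in> neg_part q"
  proof (rule bilinear_span_mem[OF bilinear_br])
    show "subspace (neg_part q)" by (simp add: neg_part_def)
    fix x y assume "x \<in> (\<Union>i\<in>{..<0}. q i)" "y \<in> (\<Union>i\<in>{..<0}. q i)"
    then obtain i j where "i < 0" "j < 0" "x \<in> q i" "y \<in> q j" by auto
    then have "br x y \<in> q (i + j)" "i + j < 0"
      using contact_br[of x i y j] by (simp_all add: q_grade_def)
    then show "br x y \<in> neg_part q" unfolding neg_part_def by (intro span_base) blast
  qed (use xy in \<open>auto simp: neg_part_def\<close>)
qed

lemma degree0_borel: "A \<in> q 0 \<Longrightarrow> degree0 A"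
  unfolding degree0_def using q_br by blast

end

text \<open>The values of \<open>\<alpha>\<close> and \<open>\<beta>\<close> at \<open>H\<close>, like the coefficients of \<open>c\<close>, solve the linear system
  \<open>E \<cdot> c = \<partial> g\<close> with \<open>g = x0\<^sup>* \<otimes> H - 3 z\<^sup>* \<otimes> x3\<close>; the solution is unique up to scale.\<close>

locale contact_frame = split_G2_algebra br h \<alpha> \<beta>
  for br :: "'v::euclidean_space \<Rightarrow> 'v \<Rightarrow> 'v" and h \<alpha> \<beta> +
  fixes E x0 x1 x2 x3 z H :: 'v
  assumes E: "E \<in> rsp 1 0" "E \<noteq> 0"
    and rsp_x: "x0 \<in> rsp 0 (-1)" "x1 \<in> rsp (-1) (-1)" "x2 \<in> rsp (-2) (-1)" "x3 \<in> rsp (-3) (-1)"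
    and rsp_z: "z \<in> rsp (-3) (-2)"
    and nonzero: "x0 \<noteq> 0" "x1 \<noteq> 0" "x2 \<noteq> 0" "x3 \<noteq> 0" "z \<noteq> 0"
    and E_br: "br E x1 = x0" "br E x2 = x1" "br E x3 = x2"
    and br_03: "br x0 x3 = z"
    and H: "H \<in> h" "\<alpha> H = 5" "\<beta> H = -9"

section \<open>An adapted basis of the negative part\<close>

context split_G2_algebra
begin

text \<open>The frame is generated from the lowest vector \<open>x\<close> of the string by applying
  \<open>e\<close>; \<open>short_string\<close> makes its members nonzero and
  \<open>highest_bracket_nonzero\<close> does so for \<open>z\<close>.\<close>

lemma contact_frame_exists:
  obtains E x0 x1 x2 x3 z H where "contact_frame br h \<alpha> \<beta> E x0 x1 x2 x3 z H"
proof -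
  obtain e x where e: "e \<in> rsp 1 0" "e \<noteq> 0" and x: "x \<in> rsp (-3) (-1)"
    and ne: "br e (br e (br e x)) \<noteq> 0"
    by (rule short_string)
  have x1: "br e x \<in> rsp (-2) (-1)" using rsp_br[OF e(1) x] by simp
  have x2: "br e (br e x) \<in> rsp (-1) (-1)" using rsp_br[OF e(1) x1] by simp
  have x3: "br e (br e (br e x)) \<in> rsp 0 (-1)" using rsp_br[OF e(1) x2] by simp
  have nz: "br e (br e x) \<noteq> 0" "br e x \<noteq> 0" "x \<noteq> 0" using ne by (auto simp: br_simps)
  have z: "br (br e (br e (br e x))) x \<in> rsp (-3) (-2)" using rsp_br[OF x3 x] by simp
  have "br (br e (br e (br e x))) x \<noteq> 0" by (rule highest_bracket_nonzero[OF x3 ne x nz(3)])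
  moreover obtain H where "H \<in> h" "\<alpha> H = 5" "\<beta> H = -9" by (rule simple_values_exist)
  ultimately have "contact_frame br h \<alpha> \<beta> e (br e (br e (br e x))) (br e (br e x)) (br e x) x
      (br (br e (br e (br e x))) x) H"
    using e x x1 x2 x3 z nz ne by unfold_locales auto
  then show ?thesis by (rule that)
qed

end

context contact_frame
begin

lemma br_frame:
  "br E x0 = 0" "br E z = 0" "br x0 x1 = 0" "br x0 x2 = 0" "br x1 x2 = - z" "br x1 x3 = 0" "br x2 x3 = 0"
  "br x0 z = 0" "br x1 z = 0" "br x2 z = 0" "br x3 z = 0"
proof -
  note zero = rsp_br_zero[OF E(1) rsp_x(1)] rsp_br_zero[OF E(1) rsp_z]
    rsp_br_zero[OF rsp_x(1,2)] rsp_br_zero[OF rsp_x(1,3)] rsp_br_zero[OF rsp_x(2,4)]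
    rsp_br_zero[OF rsp_x(3,4)] rsp_br_zero[OF rsp_x(1) rsp_z] rsp_br_zero[OF rsp_x(2) rsp_z]
    rsp_br_zero[OF rsp_x(3) rsp_z] rsp_br_zero[OF rsp_x(4) rsp_z]
  show "br E x0 = 0" "br E z = 0" "br x0 x1 = 0" "br x0 x2 = 0" "br x2 x3 = 0"
    "br x0 z = 0" "br x1 z = 0" "br x2 z = 0" "br x3 z = 0" and 13: "br x1 x3 = 0"
    by (simp_all add: zero G2_coords_def)
  \<comment> \<open>Weights do not determine \<open>br x1 x2\<close>; applying \<open>E\<close> to
    \<open>br x1 x3 = 0\<close> ties it to \<open>br x0 x3 = z\<close>.\<close>
  have "br E (br x1 x3) = br x0 x3 + br x1 x2" using jacobi[of E x1 x3] E_br by simp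
  then show "br x1 x2 = - z" using 13 br_03 by (simp add: br_simps add_eq_0_iff)
qed

lemma H_br: "br H x0 = 9 *\<^sub>R x0" "br H x1 = 4 *\<^sub>R x1" "br H x2 = - x2" "br H x3 = (-6) *\<^sub>R x3"
  "br H z = 3 *\<^sub>R z"
  using wspD[OF rsp_x(1) H(1)] wspD[OF rsp_x(2) H(1)] wspD[OF rsp_x(3) H(1)] wspD[OF rsp_x(4) H(1)]
    wspD[OF rsp_z H(1)] H(2,3)
  by (simp_all add: rt)

lemma br_frame_swap:
  "br x1 x0 = 0" "br x2 x0 = 0" "br x2 x1 = z" "br x3 x1 = 0" "br x3 x2 = 0" "br x3 x0 = - z"
  "br z x0 = 0" "br z x1 = 0" "br z x2 = 0" "br z x3 = 0"
  "br x0 H = - (9 *\<^sub>R x0)" "br x1 H = - (4 *\<^sub>R x1)" "br x2 H = x2" "br x3 H = 6 *\<^sub>R x3"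
  "br z H = - (3 *\<^sub>R z)"
proof -
  have swap: "br x y = w \<Longrightarrow> br y x = - w" for x y w using br_skew[of y x] by simp
  note sw = br_frame(3-11)[THEN swap] br_03[THEN swap] H_br[THEN swap]
  show "br x1 x0 = 0" "br x2 x0 = 0" "br x2 x1 = z" "br x3 x1 = 0" "br x3 x2 = 0" "br x3 x0 = - z"
    "br z x0 = 0" "br z x1 = 0" "br z x2 = 0" "br z x3 = 0"
    "br x0 H = - (9 *\<^sub>R x0)" "br x1 H = - (4 *\<^sub>R x1)" "br x2 H = x2" "br x3 H = 6 *\<^sub>R x3"
    "br z H = - (3 *\<^sub>R z)"
    by (simp_all add: sw)
qed

lemma rsp_frame:
  "rsp 1 0 = span {E}" "rsp 0 (-1) = span {x0}" "rsp (-1) (-1) = span {x1}" "rsp (-2) (-1) = span {x2}"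
  "rsp (-3) (-1) = span {x3}" "rsp (-3) (-2) = span {z}"
  by (rule rsp_span, simp add: G2_coords_def, fact E rsp_x rsp_z, fact E nonzero)+

lemma q0_iff: "A \<in> q 0 \<longleftrightarrow> (\<exists>K\<in>h. \<exists>c. A = K + c *\<^sub>R E)"
proof -
  have "q 0 = span (h \<union> span {E})"
    unfolding rsp_frame(1)[symmetric] using borel_eq by (simp add: q_grade_def rsp_0)
  also have "\<dots> = {x + y |x y. x \<in> h \<and> y \<in> span {E}}"
    unfolding span_Un span_span span_eq_iff[THEN iffD2, OF subspace_h] by simp
  finally show ?thesis
    unfolding span_singleton by blast
qed

lemma q_minus1: "q (-1) = span {x0, x1, x2, x3}"
proof -
  have "(\<Union>a. rsp a (-1)) \<subseteq> span {x0, x1, x2, x3}"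
  proof (rule UN_least)
    fix a :: int
    have "a \<in> {0, -1, -2, -3} \<or> rsp a (-1) = {0}"
      by (rule disjCI) (auto intro!: rsp_nonroot simp: G2_coords_def)
    then show "rsp a (-1) \<subseteq> span {x0, x1, x2, x3}"
      using rsp_frame by (auto simp: span_zero intro: subsetD[OF span_mono, rotated])
  qed
  moreover have "{x0, x1, x2, x3} \<subseteq> (\<Union>a. rsp a (-1))" using rsp_x by blast
  ultimately show ?thesis
    unfolding q_grade_def using contact_grade_eq[of "-1"]
    by (simp add: span_eq) (blast intro: span_base)
qed

lemma q_minus2: "q (-2) = span {z}"
proof -
  have "(\<Union>a. rsp a (-2)) \<subseteq> span {z}"
  proof (rule UN_least)
    fix a :: int
    have "a = -3 \<or> rsp a (-2) = {0}"
      by (rule disjCI) (auto intro!: rsp_nonroot simp: G2_coords_def)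
    then show "rsp a (-2) \<subseteq> span {z}"
      using rsp_frame(6) by (auto simp: span_zero)
  qed
  moreover have "{z} \<subseteq> (\<Union>a. rsp a (-2))" using rsp_z by blast
  ultimately show ?thesis
    unfolding q_grade_def using contact_grade_eq[of "-2"]
    by (simp add: span_eq) (blast intro: span_base)
qed

lemma q_below: "i < -2 \<Longrightarrow> q i = {0}"
proof -
  assume i: "i < -2"
  have "rsp a i = {0}" for a by (rule rsp_nonroot) (use i in \<open>auto simp: G2_coords_def\<close>)
  then show ?thesis using i contact_grade_eq[of i] by (simp add: q_grade_def)
qed

lemma neg_part_eq: "neg_part q = span {x0, x1, x2, x3, z}"
proof -
  have "(\<Union>i\<in>{..<0}. q i) \<subseteq> span {x0, x1, x2, x3, z}"
  proof (rule UN_least)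
    fix i :: int assume "i \<in> {..<0}"
    then consider "i = -1" | "i = -2" | "i < -2" by fastforce
    then show "q i \<subseteq> span {x0, x1, x2, x3, z}"
    proof cases
      case 1
      then show ?thesis unfolding 1 q_minus1 by (intro span_mono) auto
    next
      case 2
      then show ?thesis unfolding 2 q_minus2 by (intro span_mono) auto
    next
      case 3
      then show ?thesis by (simp add: q_below span_zero)
    qed
  qed
  moreover have "{x0, x1, x2, x3, z} \<subseteq> neg_part q"
    using q_neg[of "-1"] q_neg[of "-2"] by (auto simp: q_minus1 q_minus2 span_base)
  ultimately show ?thesis
    unfolding neg_part_def by (intro subset_antisym span_minimal) auto
qed

text \<open>All five vectors are eigenvectors of \<open>br H\<close>, with the distinct eigenvalues
  9, 4, -1, -6 and 3.\<close>

lemma independent_frame: "independent {x0, x1, x2, x3, z}" and distinct_frame: "distinct [x0, x1, x2, x3, z]"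
proof -
  have neq: "x \<noteq> y" if "br H x = a *\<^sub>R x" "br H y = b *\<^sub>R y" "a \<noteq> b" "x \<noteq> 0" for x y a b
    using that by auto
  have "br H x2 = (-1) *\<^sub>R x2" by (simp add: H_br)
  note eig = H_br(1,2) this H_br(4,5)
  show d: "distinct [x0, x1, x2, x3, z]"
    using neq[OF eig(1,2)] neq[OF eig(1,3)] neq[OF eig(1,4)] neq[OF eig(1,5)] neq[OF eig(2,3)]
      neq[OF eig(2,4)] neq[OF eig(2,5)] neq[OF eig(3,4)] neq[OF eig(3,5)] neq[OF eig(4,5)] nonzero
    by simp
  define \<mu> :: "'v \<Rightarrow> real" where "\<mu> x = (if x = x0 then 9 else if x = x1 then 4 else
    if x = x2 then -1 else if x = x3 then -6 else 3)" for x
  have \<mu>: "\<mu> x0 = 9" "\<mu> x1 = 4" "\<mu> x2 = -1" "\<mu> x3 = -6" "\<mu> z = 3"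
    using d by (auto simp: \<mu>_def)
  show "independent {x0, x1, x2, x3, z}"
  proof (rule independent_eigenvectors[OF linear_br])
    show "x \<noteq> 0 \<and> br H x = \<mu> x *\<^sub>R x" if "x \<in> {x0, x1, x2, x3, z}" for x
      using that nonzero by (auto simp: \<mu> H_br)
    show "inj_on \<mu> {x0, x1, x2, x3, z}" by (auto simp: inj_on_def \<mu>)
  qed simp
qed

text \<open>With values 0 and 1 these become the coordinates of the frame, extended to the whole
  space so that they are linear without side conditions.\<close>

lemma frame_functional:
  obtains u :: "'v \<Rightarrow> real" where "linear u" "u x0 = a0" "u x1 = a1" "u x2 = a2" "u x3 = a3" "u z = a4"
proof -
  define v where "v x =
      (if x = x0 then a0 else if x = x1 then a1 else if x = x2 then a2 else if x = x3 then a3 else a4)" for x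
  have v: "v x0 = a0" "v x1 = a1" "v x2 = a2" "v x3 = a3" "v z = a4"
    using distinct_frame by (auto simp: v_def)
  obtain u where u: "linear u" "\<forall>x\<in>{x0, x1, x2, x3, z}. u x = v x"
    using linear_independent_extend[OF independent_frame, of v] by blast
  show ?thesis by (rule that[of u]) (use u v in auto)
qed

section \<open>The obstructing cochain\<close>

theorem no_invariant_complement:
  assumes sub: "subspace N" and inv: "\<And>A f. A \<in> q 0 \<Longrightarrow> f \<in> N \<Longrightarrow> inf_action br q A f \<in> N"
    and compl: "complementary N (coboundary br q ` homogeneous1 q 1) (homogeneous2 q 1)"
  shows False
proof -
  obtain u0 where u0: "linear u0" "u0 x0 = 1" "u0 x1 = 0" "u0 x2 = 0" "u0 x3 = 0" "u0 z = (0::real)"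
    by (rule frame_functional)
  obtain u1 where u1: "linear u1" "u1 x0 = 0" "u1 x1 = 1" "u1 x2 = 0" "u1 x3 = 0" "u1 z = (0::real)"
    by (rule frame_functional)
  obtain u2 where u2: "linear u2" "u2 x0 = 0" "u2 x1 = 0" "u2 x2 = 1" "u2 x3 = 0" "u2 z = (0::real)"
    by (rule frame_functional)
  obtain u3 where u3: "linear u3" "u3 x0 = 0" "u3 x1 = 0" "u3 x2 = 0" "u3 x3 = 1" "u3 z = (0::real)"
    by (rule frame_functional)
  obtain uz where uz: "linear uz" "uz x0 = 0" "uz x1 = 0" "uz x2 = 0" "uz x3 = 0" "uz z = (1::real)"
    by (rule frame_functional)
  have ulin: "u (x + y) = u x + u y" "u (c *\<^sub>R x) = c * u x" "u 0 = 0" "u (- x) = - u x"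
    if "linear u" for u :: "'v \<Rightarrow> real" and x y c
    using that by (simp_all add: linear_add linear_scale linear_0 linear_neg)
  note us = u0(2-6) u1(2-6) u2(2-6) u3(2-6) uz(2-6) ulin[OF u0(1)] ulin[OF u1(1)] ulin[OF u2(1)]
    ulin[OF u3(1)] ulin[OF uz(1)]
  have expand: "x = u0 x *\<^sub>R x0 + u1 x *\<^sub>R x1 + u2 x *\<^sub>R x2 + u3 x *\<^sub>R x3 + uz x *\<^sub>R z"
    if "x \<in> neg_part q" for x
  proof (rule linear_eq_on_span[of "\<lambda>x. x" _ "{x0, x1, x2, x3, z}"])
    show "linear (\<lambda>x. u0 x *\<^sub>R x0 + u1 x *\<^sub>R x1 + u2 x *\<^sub>R x2 + u3 x *\<^sub>R x3 + uz x *\<^sub>R z)"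
      by (rule linearI) (simp_all add: us algebra_simps)
  qed (use that in \<open>auto simp: us neg_part_eq linear_id[unfolded id_def]\<close>)
  have in_neg: "x0 \<in> neg_part q" "x1 \<in> neg_part q" "x2 \<in> neg_part q" "x3 \<in> neg_part q" "z \<in> neg_part q"
    unfolding neg_part_eq by (auto intro: span_base)
  have in_q1: "x0 \<in> q (-1)" "x1 \<in> q (-1)" "x2 \<in> q (-1)" "x3 \<in> q (-1)"
    unfolding q_minus1 by (auto intro: span_base)
  have z_q1: "uz x = 0" if "x \<in> q (-1)" for x
    using linear_eq_0_on_span[OF uz(1), of "{x0, x1, x2, x3}" x] that us by (auto simp: q_minus1)
  have u_low: "u0 x = 0" "u1 x = 0" "u2 x = 0" if "x \<in> q a" "a < 0" "a \<noteq> -1" for x a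
  proof -
    have "x \<in> span {z}"
      using that q_minus2 q_below[of a] by (cases "a = -2") (auto simp: span_zero)
    then show "u0 x = 0" "u1 x = 0" "u2 x = 0" by (auto simp: span_singleton us)
  qed
  have E0: "E \<in> q 0" and h0: "K \<in> h \<Longrightarrow> K \<in> q 0" for K
  proof -
    show "E \<in> q 0" unfolding q0_iff using subspace_0[OF subspace_h]
      by (intro bexI[of _ 0] exI[of _ 1]) auto
    show "K \<in> h \<Longrightarrow> K \<in> q 0" unfolding q0_iff by (intro bexI[of _ K] exI[of _ 0]) auto
  qed
  note dE = degree0_borel[OF E0]
  define c :: "'v \<Rightarrow> 'v \<Rightarrow> 'v" where "c x y = (if x \<in> neg_part q \<and> y \<in> neg_part q then
      (4 * (u0 x * u1 y - u1 x * u0 y)) *\<^sub>R x2 + (3 * (u0 x * u2 y - u2 x * u0 y)) *\<^sub>R x3 else 0)" for x y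
  define g :: "'v \<Rightarrow> 'v" where
    "g x = (if x \<in> neg_part q then u0 x *\<^sub>R H - (3 * uz x) *\<^sub>R x3 else 0)" for x
  have c: "c \<in> homogeneous2 q 1"
    unfolding homogeneous2_def cochains2_def linear_into_def
  proof (intro CollectI conjI ballI allI impI)
    fix a b x y assume ab: "a < 0" "b < 0" "x \<in> q a" "y \<in> q b"
    show "c x y \<in> q (a + b + 1)"
    \<comment> \<open>The functionals \<open>u0\<close>, \<open>u1\<close>, \<open>u2\<close> vanish
      on degrees below -1, so \<open>c\<close> lives on pairs of degree -1. Its values there must
      have degree -1 - 1 + 1 = -1, which \<open>x2\<close> and \<open>x3\<close> have.\<close>
    proof (cases "a = -1 \<and> b = -1")
      case True
      then show ?thesis using in_q1 by (simp add: c_def q_mem)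
    next
      case False
      then have "c x y = 0" using u_low[OF ab(3,1)] u_low[OF ab(4,2)] by (auto simp: c_def)
      then show ?thesis by (simp add: q_mem)
    qed
  qed (auto simp: c_def us neg_mem algebra_simps intro!: whole_mem in_neg[THEN neg_whole])
  have g: "g \<in> homogeneous1 q 1"
    unfolding homogeneous1_iff
  proof (intro conjI ballI allI impI)
    fix a x assume ax: "a < 0" "x \<in> q a"
    show "g x \<in> q (a + 1)"
    \<comment> \<open>On degree -1 the \<open>uz\<close> term drops out and the values are multiples
      of \<open>H\<close>, of degree 0; on degree -2 the \<open>u0\<close> term drops out and they
      are multiples of \<open>x3\<close>, of degree -1.\<close>
    proof (cases "a = -1")
      case True
      then show ?thesis using ax z_q1 h0[OF H(1)] by (simp add: g_def q_mem)
    next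
      case False
      then have *: "u0 x = 0" using u_low ax by blast
      show ?thesis
      proof (cases "a = -2")
        case True
        then show ?thesis using * in_q1 by (simp add: g_def q_mem subspace_neg[OF subspace_q])
      next
        case False
        then show ?thesis using \<open>a \<noteq> -1\<close> ax q_below[of a] by (auto simp: g_def us q_mem)
      qed
    qed
  qed (auto simp: g_def us neg_mem algebra_simps intro!: whole_mem in_neg[THEN neg_whole] q_whole[OF h0[OF H(1)]])
  have Ec: "inf_action br q E c = coboundary br q g"
  proof (intro ext)
    fix x y
    show "inf_action br q E c x y = coboundary br q g x y"
    proof (cases "x \<in> neg_part q \<and> y \<in> neg_part q")
      case True
      note ex = expand[OF conjunct1[OF True]] and ey = expand[OF conjunct2[OF True]]
      have Ex: "br E x = u1 x *\<^sub>R x0 + u2 x *\<^sub>R x1 + u3 x *\<^sub>R x2"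
        by (subst ex) (simp add: br_simps br_frame E_br)
      have Ey: "br E y = u1 y *\<^sub>R x0 + u2 y *\<^sub>R x1 + u3 y *\<^sub>R x2"
        by (subst ey) (simp add: br_simps br_frame E_br)
      have xy: "br x y = (u0 x * u3 y - u3 x * u0 y - u1 x * u2 y + u2 x * u1 y) *\<^sub>R z"
        by (subst ex, subst ey) (simp add: br_simps br_frame br_03 br_frame_swap algebra_simps)
      have br_x3: "br w x3 = u0 w *\<^sub>R z" if "w \<in> neg_part q" for w
        by (subst expand[OF that]) (simp add: br_simps br_frame br_03 br_frame_swap)
      have br_H: "br w H = - ((9 * u0 w) *\<^sub>R x0) - (4 * u1 w) *\<^sub>R x1 + u2 w *\<^sub>R x2 + (6 * u3 w) *\<^sub>R x3
          - (3 * uz w) *\<^sub>R z" if "w \<in> neg_part q" for w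
        by (subst expand[OF that]) (simp add: br_simps br_frame_swap mult.commute)
      \<comment> \<open>The three lines come from \<open>E\<close> acting on the value, on the first
        argument and on the second argument of \<open>c\<close>.\<close>
      have lhs: "inf_action br q E c x y =
          (4 * (u0 x * u1 y - u1 x * u0 y)) *\<^sub>R x1 + (3 * (u0 x * u2 y - u2 x * u0 y)) *\<^sub>R x2
          - ((4 * (u1 x * u1 y - u2 x * u0 y)) *\<^sub>R x2 + (3 * (u1 x * u2 y - u3 x * u0 y)) *\<^sub>R x3)
          - ((4 * (u0 x * u2 y - u1 x * u1 y)) *\<^sub>R x2 + (3 * (u0 x * u3 y - u2 x * u1 y)) *\<^sub>R x3)"
        using True unfolding inf_action_def c_def
        by (simp add: neg_mem in_neg Ex Ey us br_simps E_br)
      have rhs: "coboundary br q g x y =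
          u0 y *\<^sub>R br x H - (3 * uz y) *\<^sub>R br x x3 - (u0 x *\<^sub>R br y H - (3 * uz x) *\<^sub>R br y x3)
          + (3 * (u0 x * u3 y - u3 x * u0 y - u1 x * u2 y + u2 x * u1 y)) *\<^sub>R x3"
        using True neg_br[of x y] unfolding coboundary_def g_def
        by (simp add: xy us br_simps)
      \<comment> \<open>Collecting the frame vectors for arbitrary scalars leaves only five
        polynomial identities between coordinates.\<close>
      have collect_lhs: "a *\<^sub>R x1 + b *\<^sub>R x2 - (c *\<^sub>R x2 + d *\<^sub>R x3) - (e *\<^sub>R x2 + f *\<^sub>R x3)
          = a *\<^sub>R x1 + (b - c - e) *\<^sub>R x2 + (- d - f) *\<^sub>R x3" for a b c d e f
        by (simp add: algebra_simps)
      have collect_rhs: "r *\<^sub>R (- (a0 *\<^sub>R x0) - a1 *\<^sub>R x1 + a2 *\<^sub>R x2 + a3 *\<^sub>R x3 - a4 *\<^sub>R z)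
            - k *\<^sub>R l *\<^sub>R z
            - (s *\<^sub>R (- (b0 *\<^sub>R x0) - b1 *\<^sub>R x1 + b2 *\<^sub>R x2 + b3 *\<^sub>R x3 - b4 *\<^sub>R z)
              - m *\<^sub>R n *\<^sub>R z) + t *\<^sub>R x3
          = (s * b0 - r * a0) *\<^sub>R x0 + (s * b1 - r * a1) *\<^sub>R x1 + (r * a2 - s * b2) *\<^sub>R x2
            + (r * a3 - s * b3 + t) *\<^sub>R x3 + (s * b4 - r * a4 - k * l + m * n) *\<^sub>R z"
        for r s k l m n t a0 a1 a2 a3 a4 b0 b1 b2 b3 b4
        by (simp add: algebra_simps)
      have coeffs: "a1 *\<^sub>R x1 + a2 *\<^sub>R x2 + a3 *\<^sub>R x3
          = b0 *\<^sub>R x0 + b1 *\<^sub>R x1 + b2 *\<^sub>R x2 + b3 *\<^sub>R x3 + b4 *\<^sub>R z"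
        if "b0 = 0" "a1 = b1" "a2 = b2" "a3 = b3" "b4 = 0" for a1 a2 a3 b0 b1 b2 b3 b4
        using that by simp
      \<comment> \<open>The \<open>x0\<close> terms cancel by symmetry. The \<open>z\<close> terms
        cancel because the eigenvalue 3 of \<open>H\<close> on \<open>z\<close> matches the factor 3
        in \<open>g\<close>.\<close>
      show ?thesis
        unfolding lhs rhs br_x3[OF conjunct1[OF True]] br_x3[OF conjunct2[OF True]]
          br_H[OF conjunct1[OF True]] br_H[OF conjunct2[OF True]] collect_lhs collect_rhs
        by (rule coeffs) (simp_all add: algebra_simps)
    qed (auto simp: inf_action_def coboundary_def)
  qed
  obtain n b where nb: "n \<in> N" "b \<in> coboundary br q ` homogeneous1 q 1" "c = n + b"
    using compl c unfolding complementary_def by blast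
  then obtain f where f: "f \<in> homogeneous1 q 1" "b = coboundary br q f" by blast
  have En: "inf_action br q E n = inf_action br q E c - inf_action br q E b"
    unfolding nb(3) by (intro ext) (simp add: inf_action_def br_simps)
  \<comment> \<open>The first term is the coboundary of \<open>g\<close> by \<open>Ec\<close>, the
    second is a coboundary by equivariance.\<close>
  have "inf_action br q E c - inf_action br q E b \<in> coboundary br q ` homogeneous1 q 1"
    unfolding f(2) Ec using g f(1)
    by (intro coboundary_image_diff inf_action_coboundary dE) auto
  then have "inf_action br q E n \<in> N \<inter> coboundary br q ` homogeneous1 q 1"
    using inv[OF E0 nb(1)] En by simp
  then have "inf_action br q E n = 0" using compl unfolding complementary_def by blast
  then have eq: "inf_action br q E c = inf_action br q E b"
    using En by simp
  have "f x0 \<in> q 0" "f x1 \<in> q 0"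
    using homogeneous1D(5)[OF f(1), of "-1"] in_q1 by simp_all
  then obtain K0 k0 K1 k1 where K: "K0 \<in> h" "K1 \<in> h" "f x0 = K0 + k0 *\<^sub>R E" "f x1 = K1 + k1 *\<^sub>R E"
    unfolding q0_iff by blast
  have x0E: "br x0 E = 0" "br x1 E = - x0" using br_skew[of E x0] br_skew[of E x1] br_frame E_br by simp_all
  have xK: "br x0 K1 = - (rt 0 (-1) K1 *\<^sub>R x0)" "br x1 K0 = - (rt (-1) (-1) K0 *\<^sub>R x1)"
    using br_skew[of K1 x0] br_skew[of K0 x1] wspD[OF rsp_x(1) K(2)] wspD[OF rsp_x(2) K(1)] by simp_all
  have f0: "f 0 = 0" using homogeneous1D(3)[OF f(1) in_neg(1), of 0] by simp
  \<comment> \<open>As \<open>E\<close> sends \<open>x0\<close> to 0 and \<open>x1\<close> to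
    \<open>x0\<close>, and \<open>b\<close> is alternating, this is just \<open>E\<close> applied to
    \<open>b x0 x1\<close>. That value lies in the plane of \<open>x0\<close> and \<open>x1\<close>,
    and \<open>E\<close> maps this plane into the line of \<open>x0\<close>.\<close>
  have "inf_action br q E b x0 x1 = rt (-1) (-1) K0 *\<^sub>R x0"
    unfolding inf_action_def f(2) coboundary_def
    using in_neg by (simp add: br_frame E_br f0 K(3,4) br_simps x0E xK)
  moreover have "inf_action br q E c x0 x1 = 4 *\<^sub>R x1"
    unfolding inf_action_def c_def using in_neg by (simp add: br_frame E_br us br_simps)
  \<comment> \<open>The coordinate \<open>u1\<close> is 4 on the left and 0 on the right.\<close>
  ultimately have "u1 (4 *\<^sub>R x1) = u1 (rt (-1) (-1) K0 *\<^sub>R x0)" using eq by simp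
  then show False by (simp add: us)
qed

end

section \<open>Invariance of the associated graded\<close>

lemma cochains2_iff:
  "f \<in> cochains2 V W \<longleftrightarrow>
     (\<forall>x\<in>V. \<forall>y\<in>V. f x y \<in> W) \<and>
     (\<forall>x\<in>V. \<forall>y\<in>V. \<forall>z\<in>V. f x (y + z) = f x y + f x z \<and> f (y + z) x = f y x + f z x) \<and>
     (\<forall>c. \<forall>x\<in>V. \<forall>y\<in>V. f x (c *\<^sub>R y) = c *\<^sub>R f x y \<and> f (c *\<^sub>R x) y = c *\<^sub>R f x y) \<and>
     (\<forall>x\<in>V. f x x = 0) \<and> (\<forall>x y. x \<notin> V \<or> y \<notin> V \<longrightarrow> f x y = 0)"
  unfolding cochains2_def linear_into_def by auto

lemma cochains2D:
  assumes "f \<in> cochains2 V W"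
  shows "x \<in> V \<Longrightarrow> y \<in> V \<Longrightarrow> f x y \<in> W"
    "x \<in> V \<Longrightarrow> y \<in> V \<Longrightarrow> z \<in> V \<Longrightarrow> f x (y + z) = f x y + f x z"
    "x \<in> V \<Longrightarrow> y \<in> V \<Longrightarrow> z \<in> V \<Longrightarrow> f (y + z) x = f y x + f z x"
    "x \<in> V \<Longrightarrow> y \<in> V \<Longrightarrow> f x (c *\<^sub>R y) = c *\<^sub>R f x y"
    "x \<in> V \<Longrightarrow> y \<in> V \<Longrightarrow> f (c *\<^sub>R x) y = c *\<^sub>R f x y"
    "x \<in> V \<Longrightarrow> f x x = 0" "x \<notin> V \<or> y \<notin> V \<Longrightarrow> f x y = 0"
  using assms unfolding cochains2_iff by blast+

lemma subspace_cochains2: "subspace W \<Longrightarrow> subspace (cochains2 V W)"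
proof (rule subspaceI)
  assume W: "subspace W"
  show "0 \<in> cochains2 V W" using W by (simp add: cochains2_iff subspace_0)
  fix f assume f: "f \<in> cochains2 V W"
  show "c *\<^sub>R f \<in> cochains2 V W" for c
    unfolding cochains2_iff scaleR_fun_def using cochains2D[OF f] W
    by (simp add: subspace_scale scaleR_add_right)
  fix g assume g: "g \<in> cochains2 V W"
  show "f + g \<in> cochains2 V W"
    unfolding cochains2_iff using cochains2D[OF f] cochains2D[OF g] W
    by (simp add: subspace_add scaleR_add_right)
qed

section \<open>Derivatives of families of linear maps and cochains\<close>

lemma subspace_projection:
  fixes W :: "'v::euclidean_space set"
  assumes "subspace W"
  obtains p where "linear p" "\<And>x. p x \<in> W" "\<And>x. x \<in> W \<Longrightarrow> p x = x"
proof -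
  have "inj_on id W" by simp
  from linear_exists_left_inverse_on[OF linear_id assms this]
  show ?thesis using that by auto
qed

text \<open>A cochain is bilinear only on \<open>W\<close> and zero off it. Precomposed with a
  projection onto \<open>W\<close> it becomes bilinear on the whole space, where expansion in a
  basis and the product rule apply.\<close>

lemma bilinear_extension:
  assumes f: "f \<in> cochains2 W V" and p: "linear p" "\<And>x. p x \<in> W"
  shows "bilinear (\<lambda>x y. f (p x) (p y))"
  unfolding bilinear_def
  by (intro conjI allI linearI) (simp_all add: cochains2D(2-5)[OF f] p linear_add linear_scale)

lemma linear_expand:
  fixes x :: "'a::euclidean_space"
  assumes "linear L"
  shows "L x = (\<Sum>b\<in>Basis. (x \<bullet> b) *\<^sub>R L b)"
  using linear_sum[OF assms, of "\<lambda>b. (x \<bullet> b) *\<^sub>R b" Basis]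
  by (simp add: euclidean_representation linear_scale[OF assms])

lemma sum_apply2: "(\<Sum>i\<in>I. f i) x y = (\<Sum>i\<in>I. f i x y)"
  by (induction I rule: infinite_finite_induct) simp_all

text \<open>There is no usable topology on the function space, so closedness of the finite-dimensional
  subspace \<open>N\<close> is replaced by a linear functional that vanishes on \<open>N\<close> but not on a hypothetical
  limit outside \<open>N\<close>; such a functional is a finite combination of coordinates.\<close>

lemma pointwise_derivative_mem:
  fixes W :: "'v::euclidean_space set"
  assumes W: "subspace W" and N: "subspace N" "N \<subseteq> cochains2 W W" and D: "D \<in> cochains2 W W"
    and e: "e > 0" "\<And>s::real. \<bar>s\<bar> < e \<Longrightarrow> F s \<in> N"
    and deriv: "\<And>x y. x \<in> W \<Longrightarrow> y \<in> W \<Longrightarrow> ((\<lambda>s. F s x y) has_vector_derivative D x y) (at 0)"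
  shows "D \<in> N"
proof (rule ccontr)
  assume "D \<notin> N"
  obtain B where B: "B \<subseteq> N" "independent B" "N \<subseteq> span B"
    using maximal_independent_subset[of N] by blast
  have span_B: "span B = N" using B span_minimal[OF B(1) N(1)] by blast
  have "independent (insert D B)" using B(2) \<open>D \<notin> N\<close> span_B by (simp add: independent_insert)
  then obtain l :: "('v \<Rightarrow> 'v \<Rightarrow> 'v) \<Rightarrow> real"
    where l: "linear l" "\<forall>x\<in>insert D B. l x = (if x = D then 1 else 0)"
    using linear_independent_extend[of "insert D B" "\<lambda>x. if x = D then 1 else 0"] by blast
  have "l x = 0" if "x \<in> B" for x using l(2) that B(1) \<open>D \<notin> N\<close> by auto
  then have lN: "l x = 0" if "x \<in> N" for x
    using linear_eq_0_on_span[OF l(1), of B x] that span_B by blast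
  have lD: "l D = 1" using l(2) by simp
  obtain p where p: "linear p" "\<And>x. p x \<in> W" "\<And>x. x \<in> W \<Longrightarrow> p x = x"
    using subspace_projection[OF W] by blast
  \<comment> \<open>These elementary maps span a space containing all cochains. They need not be
    cochains themselves, but \<open>l\<close> is defined on the whole function space.\<close>
  define \<epsilon> where "\<epsilon> b c d x y = (if x \<in> W \<and> y \<in> W then ((x \<bullet> b) * (y \<bullet> c)) *\<^sub>R d else 0)"
    for b c d x y :: 'v
  have coords: "G = (\<Sum>b\<in>Basis. \<Sum>c\<in>Basis. \<Sum>d\<in>Basis. (G (p b) (p c) \<bullet> d) *\<^sub>R \<epsilon> b c d)"
    if G: "G \<in> cochains2 W W" for G
  proof (intro ext)
    fix x y
    note bl = bilinear_extension[OF G p(1,2)]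
    have "G x y = (\<Sum>b\<in>Basis. \<Sum>c\<in>Basis. \<Sum>d\<in>Basis. (G (p b) (p c) \<bullet> d) *\<^sub>R \<epsilon> b c d x y)"
    proof (cases "x \<in> W \<and> y \<in> W")
      case True
      have "G x y = G (p x) (p y)" using True p(3) by simp
      also have "\<dots> = (\<Sum>b\<in>Basis. (x \<bullet> b) *\<^sub>R G (p b) (p y))"
        using bl unfolding bilinear_def by (intro linear_expand[of "\<lambda>x. G (p x) (p y)"]) blast
      also have "\<dots> = (\<Sum>b\<in>Basis. (x \<bullet> b) *\<^sub>R (\<Sum>c\<in>Basis. (y \<bullet> c) *\<^sub>R G (p b) (p c)))"
        using bl unfolding bilinear_def
        by (intro sum.cong refl arg_cong[of _ _ "scaleR _"] linear_expand[of "\<lambda>y. G (p _) (p y)"]) blast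
      also have "\<dots> = (\<Sum>b\<in>Basis. (x \<bullet> b) *\<^sub>R (\<Sum>c\<in>Basis. (y \<bullet> c) *\<^sub>R
          (\<Sum>d\<in>Basis. (G (p b) (p c) \<bullet> d) *\<^sub>R d)))"
        by (simp only: euclidean_representation)
      also have "\<dots> = (\<Sum>b\<in>Basis. \<Sum>c\<in>Basis. \<Sum>d\<in>Basis. (G (p b) (p c) \<bullet> d) *\<^sub>R \<epsilon> b c d x y)"
        using True by (simp add: \<epsilon>_def scaleR_sum_right mult_ac)
      finally show ?thesis .
    next
      case False
      then have "\<epsilon> b c d x y = 0" for b c d by (auto simp: \<epsilon>_def)
      moreover have "G x y = 0" using False by (intro cochains2D(7)[OF G]) blast
      ultimately show ?thesis by simp
    qed
    then show "G x y = (\<Sum>b\<in>Basis. \<Sum>c\<in>Basis. \<Sum>d\<in>Basis. (G (p b) (p c) \<bullet> d) *\<^sub>R \<epsilon> b c d) x y"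
      by (simp add: sum_apply2 scaleR_fun_def)
  qed
  have l_coords: "l G = (\<Sum>b\<in>Basis. \<Sum>c\<in>Basis. \<Sum>d\<in>Basis. (G (p b) (p c) \<bullet> d) * l (\<epsilon> b c d))"
    if "G \<in> cochains2 W W" for G
  proof -
    have "l G = l (\<Sum>b\<in>Basis. \<Sum>c\<in>Basis. \<Sum>d\<in>Basis. (G (p b) (p c) \<bullet> d) *\<^sub>R \<epsilon> b c d)"
      by (rule arg_cong[OF coords[OF that]])
    then show ?thesis by (simp add: linear_sum[OF l(1)] linear_scale[OF l(1)])
  qed
  have "((\<lambda>s. \<Sum>b\<in>Basis. \<Sum>c\<in>Basis. \<Sum>d\<in>Basis. (F s (p b) (p c) \<bullet> d) * l (\<epsilon> b c d))
      has_vector_derivative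
      (\<Sum>b\<in>Basis. \<Sum>c\<in>Basis. \<Sum>d\<in>Basis. (D (p b) (p c) \<bullet> d) * l (\<epsilon> b c d))) (at 0)"
    by (intro has_vector_derivative_sum bounded_linear.has_vector_derivative[OF bounded_linear_mult_left]
        bounded_linear.has_vector_derivative[OF bounded_linear_inner_left] deriv p)
  then have "((\<lambda>s. \<Sum>b\<in>Basis. \<Sum>c\<in>Basis. \<Sum>d\<in>Basis. (F s (p b) (p c) \<bullet> d) * l (\<epsilon> b c d))
      has_vector_derivative l D) (at 0)"
    by (simp only: l_coords[OF D])
  \<comment> \<open>For \<open>s\<close> near 0 the map \<open>F s\<close> lies in \<open>N\<close>,
    where \<open>l\<close> vanishes.\<close>
  then have "((\<lambda>s. 0) has_vector_derivative l D) (at 0)"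
  proof (rule has_vector_derivative_transform_within_open)
    fix s assume "s \<in> {-e<..<e}"
    then have "F s \<in> N" using e(2)[of s] by auto
    then show "(\<Sum>b\<in>Basis. \<Sum>c\<in>Basis. \<Sum>d\<in>Basis. (F s (p b) (p c) \<bullet> d) * l (\<epsilon> b c d)) = 0"
      using l_coords[of "F s"] lN[of "F s"] N(2) by auto
  qed (use e in auto)
  then have "l D = 0"
    using vector_derivative_unique_at[OF _ has_vector_derivative_const] by blast
  then show False using lD by simp
qed

text \<open>A product rule for a family of linear maps whose derivative is known only pointwise.
  Expanding \<open>v s\<close> in the standard basis turns \<open>M s (v s)\<close> into a finite
  sum of scalar functions times curves \<open>M s (p b)\<close>, to which the ordinary product rule
  applies.\<close>

lemma linear_family_derivative:
  fixes W :: "'v::euclidean_space set"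
  assumes W: "subspace W" and e: "e > 0"
    and M: "\<And>s::real. \<bar>s\<bar> < e \<Longrightarrow> linear_into W W (M s)" "\<And>x. x \<in> W \<Longrightarrow> M 0 x = x"
      "\<And>x. x \<in> W \<Longrightarrow> ((\<lambda>s. M s x) has_vector_derivative A x) (at 0)" "linear A"
    and v: "\<And>s. \<bar>s\<bar> < e \<Longrightarrow> v s \<in> W" "(v has_vector_derivative v') (at 0)"
  shows "((\<lambda>s. M s (v s)) has_vector_derivative A (v 0) + v') (at 0)"
proof -
  obtain p where p: "linear p" "\<And>x. p x \<in> W" "\<And>x. x \<in> W \<Longrightarrow> p x = x"
    using subspace_projection[OF W] by blast
  have "((\<lambda>s. p (v s)) has_vector_derivative p v') (at 0)"
    by (rule bounded_linear.has_vector_derivative[OF linear_conv_bounded_linear[THEN iffD1, OF p(1)] v(2)])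
  then have "(v has_vector_derivative p v') (at 0)"
  proof (rule has_vector_derivative_transform_within_open[where S = "{-e<..<e}"])
    fix s assume "s \<in> {-e<..<e}"
    then have "\<bar>s\<bar> < e" by auto
    then show "p (v s) = v s" by (intro p(3) v(1))
  qed (use e in auto)
  \<comment> \<open>The curve stays in \<open>W\<close>, so its derivative does too.\<close>
  then have pv': "p v' = v'" by (rule vector_derivative_unique_at[OF _ v(2)])
  have expand: "L (p x) = (\<Sum>b\<in>Basis. (x \<bullet> b) *\<^sub>R L (p b))" if "linear_into W W L" for L and x :: 'v
  proof -
    have "linear (\<lambda>x. L (p x))"
      using that p unfolding linear_into_def by (auto intro!: linearI simp: linear_add linear_scale)
    then show ?thesis by (rule linear_expand)
  qed
  have "((\<lambda>s. \<Sum>b\<in>Basis. (v s \<bullet> b) *\<^sub>R M s (p b)) has_vector_derivative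
      (\<Sum>b\<in>Basis. (v 0 \<bullet> b) *\<^sub>R A (p b) + (v' \<bullet> b) *\<^sub>R M 0 (p b))) (at 0)"
    using bounded_linear.has_vector_derivative[OF bounded_linear_inner_left v(2)]
    by (intro has_vector_derivative_sum has_vector_derivative_scaleR M p)
      (simp add: has_real_derivative_iff_has_vector_derivative)
  also have "(\<Sum>b\<in>Basis. (v 0 \<bullet> b) *\<^sub>R A (p b) + (v' \<bullet> b) *\<^sub>R M 0 (p b)) =
      A (p (v 0)) + p v'"
  proof -
    have "A (p (v 0)) = (\<Sum>b\<in>Basis. (v 0 \<bullet> b) *\<^sub>R A (p b))"
      by (rule linear_expand[of "\<lambda>x. A (p x)"]) (use linear_compose[OF p(1) M(4)] in \<open>simp add: o_def\<close>)
    moreover have "p v' = (\<Sum>b\<in>Basis. (v' \<bullet> b) *\<^sub>R M 0 (p b))"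
      using linear_expand[OF p(1), of v'] by (simp add: M(2) p(2))
    ultimately show ?thesis by (simp add: sum.distrib)
  qed
  finally have "((\<lambda>s. \<Sum>b\<in>Basis. (v s \<bullet> b) *\<^sub>R M s (p b)) has_vector_derivative A (v 0) + v') (at 0)"
    using e by (simp add: pv' p(3) v(1))
  then show ?thesis
  proof (rule has_vector_derivative_transform_within_open[where S = "{-e<..<e}"])
    fix s assume "s \<in> {-e<..<e}"
    then have "\<bar>s\<bar> < e" by auto
    then show "(\<Sum>b\<in>Basis. (v s \<bullet> b) *\<^sub>R M s (p b)) = M s (v s)"
      using expand[OF M(1), of s "v s"] by (simp add: p(3)[OF v(1)])
  qed (use e in auto)
qed

lemma has_derivative_along_line:
  fixes u :: "'a::real_normed_vector"
  assumes "(f has_derivative f') (at a)"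
  shows "((\<lambda>s. f (a + s *\<^sub>R u)) has_vector_derivative f' u) (at 0)"
proof -
  have "((\<lambda>s. a + s *\<^sub>R u) has_derivative (\<lambda>s. s *\<^sub>R u)) (at 0)"
    by (auto intro!: derivative_eq_intros)
  then have "((\<lambda>s. f (a + s *\<^sub>R u)) has_derivative (\<lambda>s. f' (s *\<^sub>R u))) (at 0)"
    using has_derivative_compose[of "\<lambda>s. a + s *\<^sub>R u" "\<lambda>s. s *\<^sub>R u" 0 UNIV f f'] assms by simp
  then show ?thesis
    using linear_scale[OF has_derivative_linear[OF assms]] by (simp add: has_vector_derivative_def)
qed

lemma smooth_on_has_derivative:
  assumes "smooth_on S f" "a \<in> S"
  shows "(f has_derivative frechet_derivative f (at a)) (at a)"
proof -
  have "Ck_on (Suc 0) S f" using assms(1) unfolding smooth_on_def by blast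
  then show ?thesis using assms(2) by (simp add: frechet_derivative_works[symmetric])
qed

lemma cochains2_skew:
  assumes f: "f \<in> cochains2 V W" and V: "subspace V" and xy: "x \<in> V" "y \<in> V"
  shows "f y x = - f x y"
proof -
  have s: "x + y \<in> V" by (rule subspace_add[OF V xy])
  have "f (x + y) (x + y) = f x x + f y x + (f x y + f y y)"
    by (simp only: cochains2D(2)[OF f s xy] cochains2D(3)[OF f xy(1) xy] cochains2D(3)[OF f xy(2) xy])
  then have "f x y + f y x = 0"
    by (simp add: cochains2D(6)[OF f] s xy add.commute)
  then show ?thesis by (metis add_eq_0_iff)
qed

text \<open>Stated for general \<open>V\<close> and \<open>W\<close> to serve both cochains on the
  negative part and horizontal maps on the whole algebra. The result alternates because
  \<open>f (A x) x\<close> and \<open>f x (A x)\<close> cancel.\<close>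

lemma cochains2_derivation:
  assumes f: "f \<in> cochains2 V W" and V: "subspace V" and W: "subspace W" and A: "linear A"
    and AV: "\<And>x. x \<in> V \<Longrightarrow> A x \<in> V" and AW: "\<And>x. x \<in> W \<Longrightarrow> A x \<in> W"
  shows "(\<lambda>x y. if x \<in> V \<and> y \<in> V then A (f x y) - f (A x) y - f x (A y) else 0) \<in> cochains2 V W"
    (is "?g \<in> _")
proof -
  note fs = cochains2D(1-6)[OF f]
  have g: "?g x y = A (f x y) - f (A x) y - f x (A y)" if "x \<in> V" "y \<in> V" for x y
    using that by simp
  note lA = linear_add[OF A] linear_scale[OF A] linear_0[OF A]
  note cl = AV subspace_add[OF V] subspace_scale[OF V]
  show ?thesis
    unfolding cochains2_iff
  proof (intro conjI ballI allI impI)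
    show "?g x y \<in> W" if "x \<in> V" "y \<in> V" for x y
      unfolding g[OF that] by (intro subspace_diff[OF W] AW fs(1) AV that)
    show "?g x (y + z) = ?g x y + ?g x z" "?g (y + z) x = ?g y x + ?g z x"
      if "x \<in> V" "y \<in> V" "z \<in> V" for x y z
      using that by (simp_all add: cl fs(2,3) lA)
    show "?g x (c *\<^sub>R y) = c *\<^sub>R ?g x y" "?g (c *\<^sub>R x) y = c *\<^sub>R ?g x y"
      if "x \<in> V" "y \<in> V" for c x y
      using that by (simp_all add: cl fs(4,5) lA scaleR_diff_right)
    show "?g x x = 0" if "x \<in> V" for x
      using that cochains2_skew[OF f V that AV[OF that]] by (simp add: fs(6) lA)
  qed auto
qed

section \<open>Homogeneous and filtered cochains and the associated graded\<close>

lemma (in graded_lie) homogeneous2_iff: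
  "f \<in> homogeneous2 q i \<longleftrightarrow> f \<in> cochains2 (neg_part q) (whole q) \<and>
     (\<forall>a<0. \<forall>b<0. \<forall>x\<in>q a. \<forall>y\<in>q b. f x y \<in> q (a + b + i))"
  unfolding homogeneous2_def by blast

lemma (in graded_lie) subspace_homogeneous2: "subspace (homogeneous2 q i)"
proof (rule subspaceI)
  note c = subspace_cochains2[OF subspace_whole, of "neg_part q"]
  show "0 \<in> homogeneous2 q i"
    using subspace_0[OF c] by (simp add: homogeneous2_iff q_mem)
  fix f assume f: "f \<in> homogeneous2 q i"
  show "a *\<^sub>R f \<in> homogeneous2 q i" for a
    using f subspace_scale[OF c] by (simp add: homogeneous2_iff q_mem scaleR_fun_def)
  fix g assume g: "g \<in> homogeneous2 q i"
  show "f + g \<in> homogeneous2 q i"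
    using f g subspace_add[OF c] by (simp add: homogeneous2_iff q_mem)
qed

lemma (in graded_lie) filtered2_iff:
  "f \<in> filtered2 q i \<longleftrightarrow> f \<in> cochains2 (whole q) (whole q) \<and>
     (\<forall>x\<in>filt q 0. \<forall>y\<in>whole q. f x y = 0) \<and>
     (\<forall>a b. \<forall>x\<in>filt q a. \<forall>y\<in>filt q b. f x y \<in> filt q (a + b + i))"
  unfolding filtered2_def horizontal2_def by blast

lemma (in graded_lie) subspace_filtered2: "subspace (filtered2 q i)"
proof (rule subspaceI)
  note c = subspace_cochains2[OF subspace_whole, of "whole q"]
  show "0 \<in> filtered2 q i"
    using subspace_0[OF c] by (simp add: filtered2_iff filt_mem)
  fix f assume f: "f \<in> filtered2 q i"
  show "a *\<^sub>R f \<in> filtered2 q i" for a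
    using f subspace_scale[OF c] by (simp add: filtered2_iff filt_mem scaleR_fun_def)
  fix g assume g: "g \<in> filtered2 q i"
  show "f + g \<in> filtered2 q i"
    using f g subspace_add[OF c] by (simp add: filtered2_iff filt_mem)
qed

lemma (in graded_lie) gr2_iff:
  "f0 \<in> gr2 q i N \<longleftrightarrow> f0 \<in> homogeneous2 q i \<and> (\<exists>f\<in>N \<inter> filtered2 q i.
     \<forall>a<0. \<forall>b<0. \<forall>x\<in>q a. \<forall>y\<in>q b. f x y - f0 x y \<in> filt q (a + b + i + 1))"
  unfolding gr2_def by blast

lemma (in graded_lie) subspace_gr2:
  assumes "subspace N"
  shows "subspace (gr2 q i N)"
proof (rule subspaceI)
  note h = subspace_homogeneous2[of i] and NF = subspace_inter[OF assms subspace_filtered2[of i]]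
  show "0 \<in> gr2 q i N"
    unfolding gr2_iff using subspace_0[OF h] subspace_0[OF NF] by (auto simp: filt_mem intro!: bexI[of _ 0])
  fix f0 assume "f0 \<in> gr2 q i N"
  then obtain f where f0: "f0 \<in> homogeneous2 q i" and f: "f \<in> N \<inter> filtered2 q i"
      "\<And>a b x y. a < 0 \<Longrightarrow> b < 0 \<Longrightarrow> x \<in> q a \<Longrightarrow> y \<in> q b \<Longrightarrow> f x y - f0 x y \<in> filt q (a + b + i + 1)"
    unfolding gr2_iff by blast
  show "c *\<^sub>R f0 \<in> gr2 q i N" for c
    unfolding gr2_iff
  proof (intro conjI bexI[of _ "c *\<^sub>R f"] allI impI ballI)
    fix a b :: int and x y assume "a < 0" "b < 0" "x \<in> q a" "y \<in> q b"
    from filt_mem(4)[OF f(2)[OF this], of c]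
    show "(c *\<^sub>R f) x y - (c *\<^sub>R f0) x y \<in> filt q (a + b + i + 1)"
      by (simp add: scaleR_fun_def scaleR_diff_right)
  qed (intro subspace_scale h NF f0 f(1))+
  fix g0 assume "g0 \<in> gr2 q i N"
  then obtain g where g0: "g0 \<in> homogeneous2 q i" and g: "g \<in> N \<inter> filtered2 q i"
      "\<And>a b x y. a < 0 \<Longrightarrow> b < 0 \<Longrightarrow> x \<in> q a \<Longrightarrow> y \<in> q b \<Longrightarrow> g x y - g0 x y \<in> filt q (a + b + i + 1)"
    unfolding gr2_iff by blast
  show "f0 + g0 \<in> gr2 q i N"
    unfolding gr2_iff
  proof (intro conjI bexI[of _ "f + g"] allI impI ballI)
    fix a b :: int and x y assume *: "a < 0" "b < 0" "x \<in> q a" "y \<in> q b"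
    from filt_mem(2)[OF f(2)[OF *] g(2)[OF *]]
    show "(f + g) x y - (f0 + g0) x y \<in> filt q (a + b + i + 1)"
      by (simp add: algebra_simps)
  qed (intro subspace_add h NF f0 f(1) g0 g(1))+
qed

section \<open>From the group action to the infinitesimal action\<close>

locale graded_lie_model = graded_lie br q
  for br :: "'v::euclidean_space \<Rightarrow> 'v \<Rightarrow> 'v" and q +
  fixes G :: "('g, 'm) monoid_scheme" and T :: "'g topology"
    and \<A> :: "('g set \<times> ('g \<Rightarrow> 'e::euclidean_space)) set" and \<rho> :: "'g \<Rightarrow> 'v \<Rightarrow> 'v"
  assumes model: "model_pair br q G T \<A> \<rho>"
begin

lemma group_G: "group G"
  using model unfolding model_pair_def lie_group_def by blast

lemma rho:
  assumes "g \<in> carrier G"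
  shows "linear_into (whole q) (whole q) (\<rho> g)" "x \<in> filt q k \<Longrightarrow> \<rho> g x \<in> filt q k"
  using model assms unfolding model_pair_def by blast+

lemma rho_one: "x \<in> whole q \<Longrightarrow> \<rho> \<one>\<^bsub>G\<^esub> x = x"
  and rho_mult: "g \<in> carrier G \<Longrightarrow> g' \<in> carrier G \<Longrightarrow> x \<in> whole q \<Longrightarrow> \<rho> (g \<otimes>\<^bsub>G\<^esub> g') x = \<rho> g (\<rho> g' x)"
  and rho_smooth: "(U, \<phi>) \<in> \<A> \<Longrightarrow> x \<in> whole q \<Longrightarrow> smooth_on (\<phi> ` U) (\<lambda>t. \<rho> (inv_into U \<phi> t) x)"
  using model unfolding model_pair_def by blast+

lemma chart_facts:
  assumes "(U, \<phi>) \<in> \<A>"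
  shows "U \<subseteq> carrier G" "inj_on \<phi> U" "open (\<phi> ` U)"
    "smooth_on {t. t \<in> \<phi> ` U \<and> inv\<^bsub>G\<^esub> (inv_into U \<phi> t) \<in> U} (\<lambda>t. \<phi> (inv\<^bsub>G\<^esub> (inv_into U \<phi> t)))"
proof -
  have lg: "lie_group G T \<A>" using model unfolding model_pair_def by blast
  have car: "carrier G = topspace T" using lg unfolding lie_group_def by (elim conjE)
  have man: "smooth_manifold T \<A>" using lg unfolding lie_group_def by (elim conjE)
  have "\<forall>c\<in>\<A>. chart T c" using man unfolding smooth_manifold_def by (elim conjE)
  then have "chart T (U, \<phi>)" using assms by (rule bspec)
  then have "openin T U \<and> open (\<phi> ` U) \<and> homeomorphic_map (subtopology T U) (top_of_set (\<phi> ` U)) \<phi>"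
    unfolding chart_def prod.case .
  note U = this[THEN conjunct1] this[THEN conjunct2, THEN conjunct1] this[THEN conjunct2, THEN conjunct2]
  show "U \<subseteq> carrier G" using openin_subset[OF U(1)] car by simp
  then show "inj_on \<phi> U"
    using homeomorphic_imp_injective_map[OF U(3)] car by (simp add: Int_absorb1)
  show "open (\<phi> ` U)" by (rule U(2))
  have "\<forall>(U, \<phi>)\<in>\<A>. \<forall>(W, \<theta>)\<in>\<A>.
      smooth_on {x. x \<in> \<phi> ` U \<and> inv\<^bsub>G\<^esub> (inv_into U \<phi> x) \<in> W} (\<lambda>x. \<theta> (inv\<^bsub>G\<^esub> (inv_into U \<phi> x)))"
    using lg unfolding lie_group_def by (elim conjE)
  from bspec[OF bspec[OF this assms, unfolded prod.case] assms, unfolded prod.case]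
  show "smooth_on {t. t \<in> \<phi> ` U \<and> inv\<^bsub>G\<^esub> (inv_into U \<phi> t) \<in> U} (\<lambda>t. \<phi> (inv\<^bsub>G\<^esub> (inv_into U \<phi> t)))" .
qed

text \<open>The curve is a straight segment in a chart around the unit, in the direction that
  \<open>L\<close> sends to \<open>A\<close>; it need not be a subgroup, as only its first
  derivative at 0 matters. The derivative along the inverse curve is first obtained in the form
  \<open>br (L (J u)) x\<close> from smoothness of inversion, and then identified.\<close>

lemma one_parameter_curve:
  assumes A: "A \<in> filt q 0"
  obtains g :: "real \<Rightarrow> 'g" and e :: real where "e > 0" "g 0 = \<one>\<^bsub>G\<^esub>"
    "\<And>s. \<bar>s\<bar> < e \<Longrightarrow> g s \<in> carrier G"
    "\<And>x. x \<in> whole q \<Longrightarrow> ((\<lambda>s. \<rho> (g s) x) has_vector_derivative br A x) (at 0)"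
    "\<And>x. x \<in> whole q \<Longrightarrow> ((\<lambda>s. \<rho> (inv\<^bsub>G\<^esub> (g s)) x) has_vector_derivative - br A x) (at 0)"
proof -
  have "\<exists>U \<phi> L. (U, \<phi>) \<in> \<A> \<and> \<one>\<^bsub>G\<^esub> \<in> U \<and> linear L \<and> bij_betw L UNIV (filt q 0) \<and>
      (\<forall>u v. L (lie_group_bracket G U \<phi> u v) = br (L u) (L v)) \<and>
      (\<forall>g\<in>carrier G. \<forall>u. \<rho> g (L u) = L (lie_group_Ad G U \<phi> g u)) \<and>
      (\<forall>u. \<forall>x\<in>whole q.
        frechet_derivative (\<lambda>t. \<rho> (inv_into U \<phi> t) x) (at (\<phi> \<one>\<^bsub>G\<^esub>)) u = br (L u) x)"
    (is "\<exists>U \<phi> L. ?P U \<phi> L")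
    using model unfolding model_pair_def by (elim conjE)
  then obtain U \<phi> L where P: "?P U \<phi> L" by (elim exE)
  have U: "(U, \<phi>) \<in> \<A>" "\<one>\<^bsub>G\<^esub> \<in> U" and L: "bij_betw L UNIV (filt q 0)"
    and d\<rho>: "\<And>u x. x \<in> whole q \<Longrightarrow>
      frechet_derivative (\<lambda>t. \<rho> (inv_into U \<phi> t) x) (at (\<phi> \<one>\<^bsub>G\<^esub>)) u = br (L u) x"
    using P by (elim conjE; simp)+
  note ch = chart_facts[OF U(1)]
  interpret group G by (rule group_G)
  obtain u where u: "L u = A" using L A by (metis bij_betw_imp_surj_on imageE)
  define p where "p = \<phi> \<one>\<^bsub>G\<^esub>"
  define \<psi> where "\<psi> = inv_into U \<phi>"
  define \<iota> where "\<iota> t = \<phi> (inv\<^bsub>G\<^esub> (\<psi> t))" for t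
  \<comment> \<open>On \<open>S\<close> the inverse stays in the same chart, so inversion is a
    smooth map \<open>\<iota>\<close> between coordinates there.\<close>
  define S where "S = {t. t \<in> \<phi> ` U \<and> inv\<^bsub>G\<^esub> (\<psi> t) \<in> U}"
  have \<psi>\<phi>: "x \<in> U \<Longrightarrow> \<psi> (\<phi> x) = x" for x unfolding \<psi>_def using ch(2) by (rule inv_into_f_f)
  have \<psi>U: "t \<in> \<phi> ` U \<Longrightarrow> \<psi> t \<in> U" for t using \<psi>\<phi> by auto
  have \<psi>p: "\<psi> p = \<one>\<^bsub>G\<^esub>" unfolding p_def by (rule \<psi>\<phi>[OF U(2)])
  have \<iota>p: "\<iota> p = p" unfolding \<iota>_def \<psi>p by (simp add: p_def)
  have "p \<in> \<phi> ` U" using U(2) by (simp add: p_def)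
  then have pS: "p \<in> S" using U(2) by (simp add: S_def \<psi>p)
  have sm: "smooth_on S \<iota>" using ch(4) unfolding S_def \<psi>_def \<iota>_def[abs_def] .
  then have "open S" unfolding smooth_on_def by (rule conjunct1)
  then obtain r where r: "r > 0" "ball p r \<subseteq> S" using pS openE by blast
  \<comment> \<open>Chosen so that the segment stays in \<open>ball p r\<close>; the added 1 keeps
    the denominator positive when \<open>u\<close> is zero.\<close>
  define e where "e = r / (norm u + 1)"
  have e: "e > 0" unfolding e_def using r(1) by (simp add: add_nonneg_pos)
  define c where "c s = p + s *\<^sub>R u" for s
  have cS: "c s \<in> S" if "\<bar>s\<bar> < e" for s
  proof -
    have "\<bar>s\<bar> * norm u \<le> \<bar>s\<bar> * (norm u + 1)" by (intro mult_left_mono) auto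
    also have "\<dots> < r" using that by (simp add: e_def pos_less_divide_eq add_nonneg_pos)
    finally have "c s \<in> ball p r" by (simp add: c_def dist_norm)
    then show ?thesis using r(2) by blast
  qed
  define D where "D x = frechet_derivative (\<lambda>t. \<rho> (\<psi> t) x) (at p)" for x
  have D: "((\<lambda>t. \<rho> (\<psi> t) x) has_derivative D x) (at p)" "D x v = br (L v) x" if "x \<in> whole q" for x v
    using smooth_on_has_derivative[OF rho_smooth[OF U(1) that], of p] d\<rho>[OF that] U(2)
    by (simp_all add: D_def p_def \<psi>_def)
  define J where "J = frechet_derivative \<iota> (at p)"
  have J: "(\<iota> has_derivative J) (at p)"
    unfolding J_def by (rule smooth_on_has_derivative[OF sm pS])
  have fwd: "((\<lambda>s. \<rho> (\<psi> (c s)) x) has_vector_derivative br A x) (at 0)" if "x \<in> whole q" for x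
    using has_derivative_along_line[OF D(1)[OF that], of u] D(2)[OF that, of u] u
    by (simp add: c_def)
  have bwd: "((\<lambda>s. \<rho> (inv\<^bsub>G\<^esub> (\<psi> (c s))) x) has_vector_derivative br (L (J u)) x) (at 0)"
    if "x \<in> whole q" for x
  proof -
    have "((\<lambda>t. \<rho> (\<psi> (\<iota> t)) x) has_derivative (\<lambda>v. D x (J v))) (at p)"
      using has_derivative_compose[OF J, of "\<lambda>t. \<rho> (\<psi> t) x" "D x"] D(1)[OF that] \<iota>p by simp
    from has_derivative_along_line[OF this, of u]
    have "((\<lambda>s. \<rho> (\<psi> (\<iota> (c s))) x) has_vector_derivative br (L (J u)) x) (at 0)"
      by (simp add: c_def D(2)[OF that])
    then show ?thesis
    proof (rule has_vector_derivative_transform_within_open[where S = "{-e<..<e}"])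
      fix s assume "s \<in> {-e<..<e}"
      then have "c s \<in> S" by (intro cS) auto
      then show "\<rho> (\<psi> (\<iota> (c s))) x = \<rho> (inv\<^bsub>G\<^esub> (\<psi> (c s))) x"
        unfolding \<iota>_def S_def by (simp add: \<psi>\<phi>)
    qed (use e in auto)
  qed
  have car: "\<psi> (c s) \<in> carrier G" if "\<bar>s\<bar> < e" for s
    using cS[OF that] \<psi>U ch(1) unfolding S_def by blast
  \<comment> \<open>Differentiate the constant curve in which \<open>\<rho> (\<psi> (c s))\<close>
    is applied after the action of the inverse: by the product rule the two derivatives add up to
    zero.\<close>
  have "br (L (J u)) x = - br A x" if x: "x \<in> whole q" for x
  proof -
    have lin: "linear_into (whole q) (whole q) (\<rho> (\<psi> (c s)))" if "\<bar>s\<bar> < e" for s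
      by (rule rho(1)[OF car[OF that]])
    have inv_mem: "\<rho> (inv\<^bsub>G\<^esub> (\<psi> (c s))) x \<in> whole q" if "\<bar>s\<bar> < e" for s
      using rho(1)[OF inv_closed[OF car[OF that]]] x unfolding linear_into_def by blast
    have linA: "linear (br A)" using bil unfolding bilinear_def by blast
    have at0: "\<psi> (c 0) = \<one>\<^bsub>G\<^esub>" by (simp add: c_def \<psi>p)
    have "((\<lambda>s. \<rho> (\<psi> (c s)) (\<rho> (inv\<^bsub>G\<^esub> (\<psi> (c s))) x)) has_vector_derivative
        br A (\<rho> (inv\<^bsub>G\<^esub> (\<psi> (c 0))) x) + br (L (J u)) x) (at 0)"
      by (rule linear_family_derivative[OF subspace_whole e lin _ fwd linA inv_mem bwd[OF x]])
        (simp_all add: at0 rho_one)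
    then have "((\<lambda>s. x) has_vector_derivative br A (\<rho> (inv\<^bsub>G\<^esub> (\<psi> (c 0))) x) + br (L (J u)) x) (at 0)"
    proof (rule has_vector_derivative_transform_within_open[where S = "{-e<..<e}"])
      fix s assume "s \<in> {-e<..<e}"
      then have s: "\<psi> (c s) \<in> carrier G" by (intro car) auto
      show "\<rho> (\<psi> (c s)) (\<rho> (inv\<^bsub>G\<^esub> (\<psi> (c s))) x) = x"
        using rho_mult[OF s inv_closed[OF s] x] rho_one[OF x] s by simp
    qed (use e in auto)
    from vector_derivative_unique_at[OF this has_vector_derivative_const]
    show ?thesis using rho_one[OF x] by (simp add: at0 add_eq_0_iff)
  qed
  then show ?thesis
    using that[of e "\<lambda>s. \<psi> (c s)"] e car fwd bwd by (simp add: c_def \<psi>p)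
qed

text \<open>The action of \<open>g\<close> and of its inverse preserves every filtration step.
  Horizontality enters as a hypothesis because for members of a normalization condition it follows
  from invariance.\<close>

lemma group_act2_filtered:
  assumes g: "g \<in> carrier G" and f: "f \<in> filtered2 q i" and h: "group_act2 q G \<rho> g f \<in> horizontal2 q"
  shows "group_act2 q G \<rho> g f \<in> filtered2 q i"
proof -
  interpret group G by (rule group_G)
  have "group_act2 q G \<rho> g f x y \<in> filt q (a + b + i)" if "x \<in> filt q a" "y \<in> filt q b" for x y a b
    using that f rho(2)[OF inv_closed[OF g]] rho(2)[OF g] filt_whole
    unfolding group_act2_def filtered2_def by simp
  then show ?thesis using h unfolding filtered2_def by blast
qed

text \<open>Along a curve through the unit with tangent \<open>A\<close> the transformed maps stay
  in \<open>N\<close>. Their pointwise derivative at 0 is the infinitesimal action on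
  \<open>f\<close>, and \<open>pointwise_derivative_mem\<close> puts it into
  \<open>N\<close>.\<close>

lemma group_invariant_infinitesimal:
  assumes N: "subspace N" "N \<subseteq> cochains2 (whole q) (whole q)"
    and inv: "\<And>g f. g \<in> carrier G \<Longrightarrow> f \<in> N \<Longrightarrow> group_act2 q G \<rho> g f \<in> N"
    and A: "A \<in> filt q 0" "degree0 A" and f: "f \<in> N"
  shows "(\<lambda>x y. if x \<in> whole q \<and> y \<in> whole q
    then br A (f x y) - f (br A x) y - f x (br A y) else 0) \<in> N"
proof -
  obtain g :: "real \<Rightarrow> 'g" and e :: real where e: "e > 0" and g0: "g 0 = \<one>\<^bsub>G\<^esub>"
    and car: "\<And>s. \<bar>s\<bar> < e \<Longrightarrow> g s \<in> carrier G"
    and fwd: "\<And>x. x \<in> whole q \<Longrightarrow> ((\<lambda>s. \<rho> (g s) x) has_vector_derivative br A x) (at 0)"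
    and bwd: "\<And>x. x \<in> whole q \<Longrightarrow> ((\<lambda>s. \<rho> (inv\<^bsub>G\<^esub> (g s)) x) has_vector_derivative - br A x) (at 0)"
    by (rule one_parameter_curve[OF A(1)], rule that)
  interpret group G by (rule group_G)
  have fc: "f \<in> cochains2 (whole q) (whole q)" using f N(2) by blast
  note fs = cochains2D[OF fc]
  note Aw = degree0_whole[OF A(2)]
  have linA: "linear (br A)" using bil unfolding bilinear_def by blast
  show ?thesis
  proof (rule pointwise_derivative_mem[OF subspace_whole N _ e])
    show "group_act2 q G \<rho> (g s) f \<in> N" if "\<bar>s\<bar> < e" for s
      by (rule inv[OF car[OF that] f])
    show "(\<lambda>x y. if x \<in> whole q \<and> y \<in> whole q
        then br A (f x y) - f (br A x) y - f x (br A y) else 0) \<in> cochains2 (whole q) (whole q)"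
      by (rule cochains2_derivation[OF fc subspace_whole subspace_whole linA Aw Aw])
    fix x y assume xy: "x \<in> whole q" "y \<in> whole q"
    obtain p where p: "linear p" "\<And>x. p x \<in> whole q" "\<And>x. x \<in> whole q \<Longrightarrow> p x = x"
      using subspace_projection[OF subspace_whole] by blast
    have bb: "bounded_bilinear (\<lambda>x y. f (p x) (p y))"
      using bilinear_extension[OF fc p(1,2)] by (simp add: bilinear_conv_bounded_bilinear)
    have inv_mem: "\<rho> (inv\<^bsub>G\<^esub> (g s)) z \<in> whole q" if "\<bar>s\<bar> < e" "z \<in> whole q" for s z
      using rho(1)[OF inv_closed[OF car[OF that(1)]]] that(2) unfolding linear_into_def by blast
    \<comment> \<open>The inner curve is handled by the bilinear product rule; the outer map
      \<open>\<rho> (g s)\<close> is then treated by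
      \<open>linear_family_derivative\<close>.\<close>
    define v where "v s = f (p (\<rho> (inv\<^bsub>G\<^esub> (g s)) x)) (p (\<rho> (inv\<^bsub>G\<^esub> (g s)) y))" for s
    have v0: "v 0 = f x y" using xy by (simp add: v_def g0 rho_one p(3))
    have dv: "(v has_vector_derivative - f x (br A y) - f (br A x) y) (at 0)"
    proof -
      have neg: "p (- br A z) = - br A z" if "z \<in> whole q" for z
        using Aw[OF that] p(3) linear_neg[OF p(1)] by simp
      have neg': "f w (- z) = - f w z" "f (- z) w = - f z w" if "w \<in> whole q" "z \<in> whole q" for w z
        using fs(4)[OF that, of "-1"] fs(5)[OF that(2,1), of "-1"] by simp_all
      from bounded_bilinear.has_vector_derivative[OF bb bwd[OF xy(1)] bwd[OF xy(2)]]
      show ?thesis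
        using xy Aw by (simp add: v_def[abs_def] g0 rho_one p(3) neg neg')
    qed
    have vW: "v s \<in> whole q" for s unfolding v_def by (intro fs(1) p(2))
    have "((\<lambda>s. \<rho> (g s) (v s)) has_vector_derivative br A (v 0) + (- f x (br A y) - f (br A x) y)) (at 0)"
      by (rule linear_family_derivative[OF subspace_whole e rho(1)[OF car] _ fwd linA vW dv])
        (simp_all add: g0 rho_one)
    then show "((\<lambda>s. group_act2 q G \<rho> (g s) f x y) has_vector_derivative
        (if x \<in> whole q \<and> y \<in> whole q then br A (f x y) - f (br A x) y - f x (br A y) else 0)) (at 0)"
    proof (rule has_vector_derivative_transform_within_open[where S = "{-e<..<e}", THEN has_vector_derivative_eq_rhs])
      fix s assume "s \<in> {-e<..<e}"
      then have "\<bar>s\<bar> < e" by auto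
      then show "\<rho> (g s) (v s) = group_act2 q G \<rho> (g s) f x y"
        using xy by (simp add: group_act2_def v_def p(3) inv_mem)
    qed (use e xy v0 in auto)
  qed
qed

text \<open>The infinitesimal argument is applied to \<open>N \<inter> filtered2 q i\<close>, so the
  transform \<open>F\<close> of a lift \<open>f\<close> of \<open>f0\<close> remains in
  \<open>N\<close> and in the filtration step. As \<open>A\<close> preserves degrees,
  \<open>F\<close> is a lift of the transform of \<open>f0\<close>.\<close>

lemma gr2_invariant:
  assumes N: "normalization_condition br q G \<rho> N" and A: "A \<in> filt q 0" "degree0 A"
    and f0: "f0 \<in> gr2 q i N"
  shows "inf_action br q A f0 \<in> gr2 q i N"
proof -
  have Ns: "subspace N" "N \<subseteq> horizontal2 q"
    and Ninv: "\<And>g f. g \<in> carrier G \<Longrightarrow> f \<in> N \<Longrightarrow> group_act2 q G \<rho> g f \<in> N"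
    using N unfolding normalization_condition_def by blast+
  obtain f where f0h: "f0 \<in> homogeneous2 q i" and f: "f \<in> N \<inter> filtered2 q i"
    and lead: "\<And>a b x y. a < 0 \<Longrightarrow> b < 0 \<Longrightarrow> x \<in> q a \<Longrightarrow> y \<in> q b \<Longrightarrow>
      f x y - f0 x y \<in> filt q (a + b + i + 1)"
    using f0 unfolding gr2_iff by blast
  define F where "F x y = (if x \<in> whole q \<and> y \<in> whole q
    then br A (f x y) - f (br A x) y - f x (br A y) else 0)" for x y
  have F: "F \<in> N \<inter> filtered2 q i"
    unfolding F_def[abs_def]
  proof (rule group_invariant_infinitesimal[OF _ _ _ A f])
    show "subspace (N \<inter> filtered2 q i)" by (intro subspace_inter Ns subspace_filtered2)
    show "N \<inter> filtered2 q i \<subseteq> cochains2 (whole q) (whole q)"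
      by (auto simp: filtered2_iff)
    show "group_act2 q G \<rho> g f \<in> N \<inter> filtered2 q i" if "g \<in> carrier G" "f \<in> N \<inter> filtered2 q i" for g f
      using Ninv[of g f] group_act2_filtered[of g f] Ns(2) that by blast
  qed
  have c0: "f0 \<in> cochains2 (neg_part q) (whole q)"
    and h0: "\<And>a b x y. a < 0 \<Longrightarrow> b < 0 \<Longrightarrow> x \<in> q a \<Longrightarrow> y \<in> q b \<Longrightarrow> f0 x y \<in> q (a + b + i)"
    using f0h unfolding homogeneous2_iff by blast+
  have linA: "linear (br A)" using bil unfolding bilinear_def by blast
  have "inf_action br q A f0 \<in> homogeneous2 q i"
    unfolding homogeneous2_iff
  proof (intro conjI allI impI ballI)
    show "inf_action br q A f0 \<in> cochains2 (neg_part q) (whole q)"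
      unfolding inf_action_def
      by (rule cochains2_derivation[OF c0 subspace_neg_part subspace_whole linA
            degree0_neg[OF A(2)] degree0_whole[OF A(2)]])
    fix a b :: int and x y assume ab: "a < 0" "b < 0" and xy: "x \<in> q a" "y \<in> q b"
    have "br A (f0 x y) - f0 (br A x) y - f0 x (br A y) \<in> q (a + b + i)"
      by (intro q_mem(3) degree0_q[OF A(2)] h0 ab xy)
    then show "inf_action br q A f0 x y \<in> q (a + b + i)"
      using q_neg[OF ab(1) xy(1)] q_neg[OF ab(2) xy(2)] by (simp add: inf_action_def)
  qed
  moreover have "F x y - inf_action br q A f0 x y \<in> filt q (a + b + i + 1)"
    if ab: "a < 0" "b < 0" and xy: "x \<in> q a" "y \<in> q b" for a b x y
  proof -
    \<comment> \<open>By linearity this is the action of \<open>A\<close> on the error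
      \<open>f - f0\<close>, and each of the three terms stays one filtration step higher.\<close>
    have "F x y - inf_action br q A f0 x y =
        br A (f x y - f0 x y) - (f (br A x) y - f0 (br A x) y) - (f x (br A y) - f0 x (br A y))"
      using q_neg[OF ab(1) xy(1)] q_neg[OF ab(2) xy(2)] q_whole[OF xy(1)] q_whole[OF xy(2)]
      by (simp add: F_def inf_action_def bs)
    also have "\<dots> \<in> filt q (a + b + i + 1)"
      by (intro filt_mem(3) degree0_filt[OF A(2)] lead ab xy degree0_q[OF A(2)])
    finally show ?thesis .
  qed
  ultimately show ?thesis unfolding gr2_iff using F by blast
qed

end

section \<open>The two non-existence statements\<close>

theorem proposition25:
  fixes br :: "'v::euclidean_space \<Rightarrow> 'v \<Rightarrow> 'v" and h :: "'v set" and \<alpha> \<beta> :: "'v \<Rightarrow> real"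
    and q :: "int \<Rightarrow> 'v set"
    and G :: "('g, 'm) monoid_scheme" and T :: "'g topology"
    and \<A> :: "('g set \<times> ('g \<Rightarrow> 'e::euclidean_space)) set" and \<rho> :: "'g \<Rightarrow> 'v \<Rightarrow> 'v"
  assumes "split_G2 br h \<alpha> \<beta>"
    and "q = q_grade br h \<alpha> \<beta>"
  shows "(\<nexists>N. subspace N \<and> (\<forall>A\<in>q 0. \<forall>f\<in>N. inf_action br q A f \<in> N) \<and>
            complementary N (coboundary br q ` homogeneous1 q 1) (homogeneous2 q 1)) \<and>
         (model_pair br q G T \<A> \<rho> \<longrightarrow> (\<nexists>N. normalization_condition br q G \<rho> N))"
proof -
  interpret G2: split_G2_algebra br h \<alpha> \<beta> by unfold_locales (rule assms(1))
  obtain E x0 x1 x2 x3 z H where "contact_frame br h \<alpha> \<beta> E x0 x1 x2 x3 z H"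
    by (rule G2.contact_frame_exists)
  then interpret contact_frame br h \<alpha> \<beta> E x0 x1 x2 x3 z H .
  have part1: False
    if "subspace N" "\<And>A f. A \<in> q 0 \<Longrightarrow> f \<in> N \<Longrightarrow> inf_action br q A f \<in> N"
      "complementary N (coboundary br q ` homogeneous1 q 1) (homogeneous2 q 1)" for N
    using no_invariant_complement[of N] that unfolding assms(2) by blast
  moreover have False
    if model: "model_pair br q G T \<A> \<rho>" and N: "normalization_condition br q G \<rho> N" for N
  \<comment> \<open>The degree 1 component of the associated graded of \<open>N\<close> would be an
    invariant complement.\<close>
  proof (rule part1)
    interpret M: graded_lie_model br "q_grade br h \<alpha> \<beta>" G T \<A> \<rho>
      by unfold_locales (use model assms(2) in simp)
    show "subspace (gr2 q 1 N)"
      using G2.subspace_gr2 N unfolding assms(2) normalization_condition_def by blast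
    show "complementary (gr2 q 1 N) (coboundary br q ` homogeneous1 q 1) (homogeneous2 q 1)"
      using N unfolding normalization_condition_def by simp
    fix A f assume "A \<in> q 0" "f \<in> gr2 q 1 N"
    then show "inf_action br q A f \<in> gr2 q 1 N"
      using M.gr2_invariant[of N A f 1] N G2.degree0_borel[of A] G2.q_filt[of 0 0 A]
      unfolding assms(2) by simp
  qed
  ultimately show ?thesis by blast
qed

end
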